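(* Let $N=2$ or $N=3$. Let $A(x')$ be an $N\times N$ matrix of the form $$A(x')=\begin{pmatrix}\widehat{A}(x')&0\\0&1\end{pmatrix},$$ where $\widehat{A}(x')=(a_{ij}(x'))$ is an $(N-1)\times(N-1)$ symmetric real matrix with entries $a_{ij}\in C^1(\mathbb{R}^{N-1})\cap L^\infty(\mathbb{R}^{N-1})$ such that $$\sum_{i,j=1}^{N-1}a_{ij}(x')\xi_i\xi_j>0\qquad\text{for all }x'\in\mathbb{R}^{N-1}\text{ and all }\xi\in\mathbb{R}^{N-1}\setminus\{0\}.$$ Suppose $u\in\mathcal{C}^2(\overline{\mathbb{R}^N_+})$ solves $$-\mathrm{div}(A(x')\nabla u)=u-1\ \text{ in }\mathbb{R}^N_+,\qquad u=0\ \text{ on }\partial\mathbb{R}^N_+,$$ and that for every $M>0$ there exists $C(M)>0$ such that $0\le u(x)\le C(M)$ for all $x\in\mathbb{R}^{N-1}\times[0,M]$. Then $$u(x',x_N)=1-\cos x_N .$$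
   Context: $\mathbb{R}^N_+:=\mathbb{R}^{N-1}\times(0,+\infty)$, and its points are written $x=(x',x_N)$ with $x'\in\mathbb{R}^{N-1}$. The operator is not assumed to be uniformly elliptic. If $N=2$, $\widehat A$ is a positive scalar function. *)

theory Defs
  imports "HOL-Analysis.Analysis"
begin

definition partial :: "'a::euclidean_space \<Rightarrow> ('a \<Rightarrow> real) \<Rightarrow> 'a \<Rightarrow> real" where
  "partial b f x = deriv (\<lambda>t. f (x + t *\<^sub>R b)) 0"

definition grad :: "('a::euclidean_space \<Rightarrow> real) \<Rightarrow> 'a \<Rightarrow> 'a" where
  "grad f x = (\<Sum>b\<in>Basis. partial b f x *\<^sub>R b)"

definition divergence :: "('a::euclidean_space \<Rightarrow> 'a) \<Rightarrow> 'a \<Rightarrow> real" where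
  "divergence F x = (\<Sum>b\<in>Basis. partial b (\<lambda>y. F y \<bullet> b) x)"

text \<open>The class $C^k(S)$, for open \<open>S\<close>. Since \<^const>\<open>partial\<close> is total, differentiability
  has to be required explicitly.\<close>

primrec Ck_on :: "nat \<Rightarrow> 'a::euclidean_space set \<Rightarrow> ('a \<Rightarrow> real) \<Rightarrow> bool" where
  "Ck_on 0 S f \<longleftrightarrow> continuous_on S f"
| "Ck_on (Suc k) S f \<longleftrightarrow> f differentiable_on S \<and> (\<forall>b\<in>Basis. Ck_on k S (partial b f))"

definition extends_cont :: "'a::euclidean_space set \<Rightarrow> ('a \<Rightarrow> real) \<Rightarrow> bool" where
  "extends_cont S f \<longleftrightarrow> (\<exists>g. continuous_on (closure S) g \<and> (\<forall>x\<in>S. g x = f x))"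

text \<open>For open \<open>S\<close>: all partial derivatives of order at most \<open>k\<close> exist in \<open>S\<close> and have continuous
  extensions to the closure. Only the values of \<open>f\<close> on \<open>S\<close> itself matter here.\<close>

primrec Ck_extends :: "nat \<Rightarrow> 'a::euclidean_space set \<Rightarrow> ('a \<Rightarrow> real) \<Rightarrow> bool" where
  "Ck_extends 0 S f \<longleftrightarrow> extends_cont S f"
| "Ck_extends (Suc k) S f \<longleftrightarrow>
     extends_cont S f \<and> f differentiable_on S \<and> (\<forall>b\<in>Basis. Ck_extends k S (partial b f))"

text \<open>The class $C^k(\overline S)$, for open \<open>S\<close>. No bound on \<open>f\<close> or its derivatives is included.
  The first conjunct ties the values of \<open>f\<close> on the boundary to those inside.\<close>

definition Ck_closure :: "nat \<Rightarrow> 'a::euclidean_space set \<Rightarrow> ('a \<Rightarrow> real) \<Rightarrow> bool" where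
  "Ck_closure k S f \<longleftrightarrow> continuous_on (closure S) f \<and> Ck_extends k S f"

definition L_infinity :: "('a::euclidean_space \<Rightarrow> real) \<Rightarrow> bool" where
  "L_infinity f \<longleftrightarrow> f \<in> borel_measurable lebesgue \<and> (\<exists>C. AE x in lebesgue. \<bar>f x\<bar> \<le> C)"

text \<open>$\mathbb{R}^N$ is \<open>(real^'n) \<times> real\<close>, where \<open>'n\<close> has $N-1$ elements, so that
  \<open>(x', xN)\<close> is literally a pair.\<close>

definition half_space :: "((real^'n) \<times> real) set" where
  "half_space = UNIV \<times> {0<..}"

text \<open>Multiplication of a column vector, split as \<open>(v, t)\<close>, by the block matrix
  with diagonal blocks \<open>B\<close> and $1$ and zero off-diagonal blocks.\<close>

definition block_mult :: "real^'n^'n \<Rightarrow> (real^'n) \<times> real \<Rightarrow> (real^'n) \<times> real" where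
  "block_mult B = (\<lambda>(v, t). (B *v v, t))"

end

theory Submission
  imports Defs
begin

text \<open>The function $v = u - (1 - \cos x_N)$ solves the homogeneous equation
$-\mathrm{div}(A\nabla v) = v$ and vanishes for $x_N = 0$. Since $A$ does not depend on
$x_N$, the normal variable can be integrated out: on a strip $l \le x_N \le r$ on whose lower
face $v$ vanishes, the moment
$\phi_\mu(x') = \int_l^r v(x', t) \sin(\mu (t - l))\,dt$ satisfies
\[ \mathrm{div}(\widehat A \nabla \phi_\mu)
   = (\mu^2 - 1)\phi_\mu - v_N(x', r) \sin(\mu (r - l)) + \mu\, v(x', r) \cos(\mu (r - l)) . \]
This is an equation on $\mathbb{R}^{N-1}$ with $N - 1 \le 2$, where bounded matrices $\widehat A$
are parabolic, no matter how degenerate they are: a bounded $\phi$ with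
$\phi\,\mathrm{div}(\widehat A\nabla\phi) \ge 0$ must have $\phi\,\mathrm{div}(\widehat A\nabla\phi) = 0$
(\<open>parabolic_liouville\<close>).

Take $l = 2\pi m$ and $r = l + 2\pi$. For $\mu = 1$ the right-hand side is
$v(x', r) = u(x', r) \ge 0$. Adding a constant to $\phi_1$ makes it positive, and the Liouville
theorem yields $u(x', r) = 0$. As $u \ge 0$, every point of the upper face is a minimum of
$u$ in the normal direction, so that $u_N(x', r) = 0$ as well. Now $v$ has zero Cauchy data on the upper
face, both boundary terms disappear for every $\mu$, and for $\mu > 1$ the Liouville
theorem gives $\phi_\mu = 0$. A continuous function is determined by its sine
moments for all large $\mu$ (\<open>sine_moments_zero_imp_zero\<close>), hence $v = 0$ on
the strip. In particular $u$ vanishes on the upper face, which is the lower face of the next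
strip, and induction on $m$ covers the half-space (\<open>solution_unique\<close>).\<close>

section \<open>Integration by parts without boundary terms\<close>

lemma open_AE_notin_empty:
  fixes S :: "'a::euclidean_space set"
  assumes "open S" "AE x in lebesgue. x \<notin> S"
  shows "S = {}"
proof -
  have "S \<in> null_sets lebesgue"
  proof (subst AE_iff_null_sets)
    show "S \<in> sets lebesgue" using assms(1) by (simp add: borel_open)
  qed (rule assms(2))
  hence "negligible S" by (simp add: negligible_iff_null_sets)
  thus ?thesis using assms(1) open_not_negligible by blast
qed

lemma integrable_compact_support:
  fixes f :: "'a::euclidean_space \<Rightarrow> real"
  assumes "continuous_on UNIV f" "\<And>x. norm x \<ge> R \<Longrightarrow> f x = 0"
  shows "integrable lborel f"
proof -
  have "integrable lborel (\<lambda>x. indicator (cball 0 R) x *\<^sub>R f x)"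
    by (intro borel_integrable_compact continuous_on_subset[OF assms(1)]) auto
  moreover have "(\<lambda>x. indicator (cball 0 R) x *\<^sub>R f x) = f"
    using assms(2) by (auto simp: fun_eq_iff indicator_def)
  ultimately show ?thesis by simp
qed

lemma has_real_derivative_shift_line:
  fixes f :: "'a::real_normed_vector \<Rightarrow> real"
  assumes "\<And>x. ((\<lambda>s. f (x + s *\<^sub>R e)) has_real_derivative f' x) (at 0)"
  shows "((\<lambda>s. f (x + s *\<^sub>R e)) has_real_derivative f' (x + r *\<^sub>R e)) (at r)"
proof -
  have "((\<lambda>s. f ((x + r *\<^sub>R e) + s *\<^sub>R e)) has_real_derivative f' (x + r *\<^sub>R e)) (at (r - r))"
    using assms[of "x + r *\<^sub>R e"] by simp
  moreover have "((\<lambda>s. s - r) has_real_derivative 1) (at r)"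
    by (auto intro!: derivative_eq_intros)
  ultimately have "((\<lambda>s. f ((x + r *\<^sub>R e) + (s - r) *\<^sub>R e)) has_real_derivative f' (x + r *\<^sub>R e) * 1) (at r)"
    by (rule DERIV_chain2)
  thus ?thesis by (simp add: algebra_simps)
qed

text \<open>Lebesgue measure is invariant under translations, so the difference quotients of $f$
in direction $e$ have integral zero. They converge boundedly, and with supports in
a common ball, to the directional derivative.\<close>

lemma integral_directional_derivative_eq_0:
  fixes f f' :: "'a::euclidean_space \<Rightarrow> real"
  assumes deriv: "\<And>x. ((\<lambda>s. f (x + s *\<^sub>R e)) has_real_derivative f' x) (at 0)"
    and contf: "continuous_on UNIV f" and contf': "continuous_on UNIV f'"
    and supp: "\<And>x. norm x \<ge> R \<Longrightarrow> f x = 0"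
  shows "(LINT x|lborel. f' x) = 0"
proof -
  define h where "h n = inverse (real (Suc n))" for n
  have h: "0 < h n" "h n \<le> 1" for n by (auto simp: h_def field_simps)
  have hlim: "h \<longlonglongrightarrow> 0" unfolding h_def by (rule LIMSEQ_inverse_real_of_nat)
  define q where "q n x = (f (x + h n *\<^sub>R e) - f x) / h n" for n x
  have int_f: "integrable lborel f" by (rule integrable_compact_support[OF contf supp])
  have fm: "f \<in> borel_measurable borel" "f' \<in> borel_measurable borel"
    using contf contf' by (simp_all add: borel_measurable_continuous_onI)
  have shift: "integrable lborel (\<lambda>x. f (x + c)) \<and> (LINT x|lborel. f (x + c)) = (LINT x|lborel. f x)" for c
  proof -
    have d: "distr lborel borel ((+) c) = (lborel :: 'a measure)" by (rule lborel_distr_plus)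
    have "integrable (distr lborel borel ((+) c)) f" using int_f d by simp
    hence i: "integrable lborel (\<lambda>x. f (c + x))" by (subst (asm) integrable_distr_eq) (use fm in auto)
    have "(LINT x|distr lborel borel ((+) c). f x) = (LINT x|lborel. f (c + x))"
      by (subst integral_distr) (use fm in auto)
    with i d show ?thesis by (simp add: add.commute)
  qed
  have q0: "(LINT x|lborel. q n x) = 0" for n
    unfolding q_def using shift[of "h n *\<^sub>R e"] int_f by simp
  have qm: "q n \<in> borel_measurable lborel" for n
    unfolding q_def using shift[of "h n *\<^sub>R e"] int_f
    by (intro borel_measurable_divide borel_measurable_diff) auto
  have lim: "(\<lambda>n. q n x) \<longlonglongrightarrow> f' x" for x
  proof -
    have "((\<lambda>s. (f (x + s *\<^sub>R e) - f x) / s) \<longlongrightarrow> f' x) (at 0)"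
      using deriv[of x] by (simp add: DERIV_def)
    moreover have "filterlim h (at 0) sequentially"
      using hlim h(1) by (intro filterlim_atI) (auto simp: h_def)
    ultimately show ?thesis unfolding q_def by (rule filterlim_compose)
  qed
  define T where "T = \<bar>R\<bar> + norm e"
  have "compact (f' ` cball 0 (T + norm e))"
    by (intro compact_continuous_image continuous_on_subset[OF contf']) auto
  hence "bounded (f' ` cball 0 (T + norm e))" by (rule compact_imp_bounded)
  then obtain M where "\<forall>y \<in> f' ` cball 0 (T + norm e). norm y \<le> M"
    unfolding bounded_iff by blast
  hence M: "\<bar>f' x\<bar> \<le> M" if "x \<in> cball 0 (T + norm e)" for x
    using that by auto
  have he: "norm (h n *\<^sub>R e) \<le> norm e" for n
    using mult_left_le_one_le[of "norm e" "h n"] h[of n] by simp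
  have bound: "norm (q n x) \<le> M * indicator (cball 0 T) x" for n x
  proof (cases "norm x \<le> T")
    case True
    have "\<exists>z>0. z < h n \<and> f (x + h n *\<^sub>R e) - f (x + 0 *\<^sub>R e) = (h n - 0) * f' (x + z *\<^sub>R e)"
      
      by (rule MVT2[OF h(1)], rule has_real_derivative_shift_line[OF deriv])
    then obtain z where z: "0 < z" "z < h n" "f (x + h n *\<^sub>R e) - f x = h n * f' (x + z *\<^sub>R e)"
      by auto
    have "norm (x + z *\<^sub>R e) \<le> T + norm e"
    proof -
      have "z < 1" using z h(2)[of n] by linarith
      hence "norm (z *\<^sub>R e) \<le> norm e" using mult_left_le_one_le[of "norm e" z] z(1) by simp
      thus ?thesis using True norm_triangle_ineq[of x "z *\<^sub>R e"] by linarith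
    qed
    hence "\<bar>f' (x + z *\<^sub>R e)\<bar> \<le> M" using M by simp
    moreover have "q n x = f' (x + z *\<^sub>R e)" using z(3) h(1)[of n] by (simp add: q_def)
    ultimately show ?thesis using True by simp
  next
    case False
    have "norm x - norm (h n *\<^sub>R e) \<le> norm (x + h n *\<^sub>R e)"
      using norm_diff_ineq by blast
    hence "norm (x + h n *\<^sub>R e) \<ge> R" using False he[of n] unfolding T_def by linarith
    moreover have "norm x \<ge> R" using False unfolding T_def by (smt (verit) norm_ge_zero)
    ultimately have "f x = 0" "f (x + h n *\<^sub>R e) = 0" using supp by auto
    thus ?thesis using False by (simp add: q_def)
  qed
  have "(\<lambda>n. LINT x|lborel. q n x) \<longlonglongrightarrow> (LINT x|lborel. f' x)"
  proof (rule integral_dominated_convergence)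
    show "integrable lborel (\<lambda>x::'a. M * indicator (cball 0 T) x)"
    proof -
      have "integrable lborel (\<lambda>x::'a. indicator (cball 0 T) x *\<^sub>R M)"
        by (intro borel_integrable_compact) auto
      thus ?thesis by (simp add: mult.commute)
    qed
    show "f' \<in> borel_measurable lborel" using fm(2) by simp
    show "q n \<in> borel_measurable lborel" for n by (rule qm)
    show "AE x in lborel. (\<lambda>n. q n x) \<longlonglongrightarrow> f' x" using lim by simp
    show "AE x in lborel. norm (q n x) \<le> M * indicator (cball 0 T) x" for n using bound by simp
  qed
  hence "(\<lambda>n. 0) \<longlonglongrightarrow> (LINT x|lborel. f' x)" by (simp only: q0)
  thus ?thesis by (rule LIMSEQ_unique) (rule tendsto_const)
qed

text \<open>The square of the positive part is the simplest $C^1$ truncation; the cut-off functions of the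
Liouville theorem are made from it.\<close>

lemma has_real_derivative_max_0_sq:
  fixes f :: "real \<Rightarrow> real"
  assumes "(f has_real_derivative f') (at x)"
  shows "((\<lambda>s. (max 0 (f s))\<^sup>2) has_real_derivative 2 * max 0 (f x) * f') (at x)"
proof -
  have "((\<lambda>y::real. (max 0 y)\<^sup>2) has_real_derivative 2 * max 0 y) (at y)" for y
  proof -
    consider "y > 0" | "y < 0" | "y = 0" by linarith
    thus ?thesis
    proof cases
      case 1
      have "((\<lambda>y::real. y\<^sup>2) has_real_derivative 2 * max 0 y) (at y)"
        using 1 by (auto intro!: derivative_eq_intros)
      thus ?thesis
        by (rule has_field_derivative_transform_within_open[where S="{0<..}"]) (use 1 in auto)
    next
      case 2
      have "((\<lambda>y::real. 0) has_real_derivative 2 * max 0 y) (at y)"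
        using 2 by (auto intro!: derivative_eq_intros)
      thus ?thesis
        by (rule has_field_derivative_transform_within_open[where S="{..<0}"]) (use 2 in auto)
    next
      case 3
      have "((\<lambda>h::real. (max 0 h)\<^sup>2 / h) \<longlongrightarrow> 0) (at 0)"
      proof (rule Lim_null_comparison)
        show "\<forall>\<^sub>F h in at 0. norm ((max 0 h)\<^sup>2 / h) \<le> \<bar>h\<bar>"
          by (rule always_eventually) (auto simp: max_def power2_eq_square)
        show "((\<lambda>h::real. \<bar>h\<bar>) \<longlongrightarrow> 0) (at 0)" by (rule tendsto_rabs_zero[OF tendsto_ident_at])
      qed
      thus ?thesis using 3 by (simp add: DERIV_def)
    qed
  qed
  from DERIV_chain2[OF this assms] show ?thesis by simp
qed

section \<open>A Liouville theorem in dimension at most two\<close>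

text \<open>Young's inequality for the semidefinite form $B$: expand
$0 \le B(pG + lqS,\, pG + lqS)$ and divide by $l$.\<close>

lemma quadratic_form_young:
  fixes B :: "'n::finite \<Rightarrow> 'n \<Rightarrow> real"
  assumes sym: "\<And>i j. B i j = B j i"
    and psd: "\<And>\<xi>. 0 \<le> (\<Sum>i\<in>UNIV. \<Sum>j\<in>UNIV. B i j * \<xi> i * \<xi> j)"
    and l: "l > 0"
  shows "- (2 * p * q * (\<Sum>i\<in>UNIV. S i * (\<Sum>j\<in>UNIV. B i j * G j)))
           \<le> p\<^sup>2 * (\<Sum>i\<in>UNIV. G i * (\<Sum>j\<in>UNIV. B i j * G j)) / l
             + l * q\<^sup>2 * (\<Sum>i\<in>UNIV. S i * (\<Sum>j\<in>UNIV. B i j * S j))"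
proof -
  define Q where "Q \<xi> \<zeta> = (\<Sum>i\<in>UNIV. \<Sum>j\<in>UNIV. B i j * \<xi> i * \<zeta> j)" for \<xi> \<zeta>
  have Q: "(\<Sum>i\<in>UNIV. \<xi> i * (\<Sum>j\<in>UNIV. B i j * \<zeta> j)) = Q \<xi> \<zeta>" for \<xi> \<zeta>
    unfolding Q_def by (simp add: sum_distrib_left algebra_simps)
  have Qsym: "Q \<xi> \<zeta> = Q \<zeta> \<xi>" for \<xi> \<zeta>
  proof -
    have "Q \<xi> \<zeta> = (\<Sum>j\<in>UNIV. \<Sum>i\<in>UNIV. B i j * \<xi> i * \<zeta> j)"
      unfolding Q_def by (rule sum.swap)
    also have "\<dots> = (\<Sum>j\<in>UNIV. \<Sum>i\<in>UNIV. B j i * \<zeta> j * \<xi> i)"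
      by (intro sum.cong refl) (subst sym, simp)
    finally show ?thesis unfolding Q_def .
  qed
  define \<xi> where "\<xi> i = p * G i + (l * q) * S i" for i
  have "Q \<xi> \<xi> = p\<^sup>2 * Q G G + p * (l * q) * Q G S + (l * q) * p * Q S G + (l * q)\<^sup>2 * Q S S"
    unfolding Q_def \<xi>_def
    by (simp add: sum_distrib_left sum.distrib[symmetric] power2_eq_square algebra_simps)
  hence "0 \<le> p\<^sup>2 * Q G G + 2 * l * (p * q * Q S G) + (l * q)\<^sup>2 * Q S S"
    using psd[of \<xi>] Qsym[of G S] unfolding Q_def[symmetric] by (simp add: algebra_simps)
  hence "0 \<le> (p\<^sup>2 * Q G G + 2 * l * (p * q * Q S G) + (l * q)\<^sup>2 * Q S S) / l"
    using l by simp
  also have "\<dots> = p\<^sup>2 * Q G G / l + 2 * (p * q * Q S G) + l * q\<^sup>2 * Q S S"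
    using l by (simp add: field_simps power2_eq_square)
  finally show ?thesis unfolding Q by (simp add: algebra_simps)
qed

lemma has_real_derivative_sq_norm_line:
  fixes x :: "real^'n::finite"
  shows "((\<lambda>s. (x + s *\<^sub>R axis i 1) \<bullet> (x + s *\<^sub>R axis i 1)) has_real_derivative 2 * x $ i) (at 0)"
proof -
  have "(x + s *\<^sub>R axis i 1) \<bullet> (x + s *\<^sub>R axis i 1) = x \<bullet> x + 2 * s * x $ i + s * s" for s
    by (simp add: inner_simps inner_axis inner_commute[of "axis i 1" x] inner_axis_axis algebra_simps)
  thus ?thesis by (auto intro!: derivative_eq_intros)
qed

text \<open>Here $F = \mathrm{div}(a\nabla\phi)$ is the sum of the \<open>dV i\<close> and $E = \nabla\phi\cdot a\nabla\phi$.
Testing with $z\phi$, where the cut-off $z = \eta^2$ is $1$ on the ball of radius $R$ and $0$ outside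
the ball of radius $2R$, gives
$\int z (\phi F + E) = - \int 2 \eta\phi\, \nabla\eta\cdot a\nabla\phi$.
Since $|\nabla\eta| \le \mathrm{const}/R$ and the ball has volume at most of order $R^2$, the
integral of $\nabla\eta\cdot a\nabla\eta$ stays bounded as $R \to \infty$; this is the only place where
the dimension enters. Young's inequality first bounds the energy $\int E$ over the whole
space. The error term only involves $E$ on the annulus where $\nabla\eta$ lives, so it now tends to
zero, and $\int \phi F = 0$.\<close>

lemma parabolic_liouville:
  fixes a :: "'n::finite \<Rightarrow> 'n \<Rightarrow> real^'n \<Rightarrow> real" and \<phi> :: "real^'n \<Rightarrow> real"
    and G dV :: "'n \<Rightarrow> real^'n \<Rightarrow> real"
  assumes dim: "CARD('n) \<le> 2"
    and sym: "\<And>i j x. a i j x = a j i x"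
    and psd: "\<And>x \<xi>. 0 \<le> (\<Sum>i\<in>UNIV. \<Sum>j\<in>UNIV. a i j x * \<xi> i * \<xi> j)"
    and bnd: "\<And>i j x. \<bar>a i j x\<bar> \<le> \<Lambda>"
    and a_cont: "\<And>i j. continuous_on UNIV (a i j)"
    and \<phi>_cont: "continuous_on UNIV \<phi>"
    and G_cont: "\<And>i. continuous_on UNIV (G i)"
    and dV_cont: "\<And>i. continuous_on UNIV (dV i)"
    and \<phi>_deriv: "\<And>i x. ((\<lambda>s. \<phi> (x + s *\<^sub>R axis i 1)) has_real_derivative G i x) (at 0)"
    and V_deriv: "\<And>i x. ((\<lambda>s. \<Sum>j\<in>UNIV. a i j (x + s *\<^sub>R axis i 1) * G j (x + s *\<^sub>R axis i 1))
                     has_real_derivative dV i x) (at 0)"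
    and \<phi>_bnd: "\<And>x. \<bar>\<phi> x\<bar> \<le> K"
    and sgn: "\<And>x. 0 \<le> \<phi> x * (\<Sum>i\<in>UNIV. dV i x)"
  shows "\<phi> x * (\<Sum>i\<in>UNIV. dV i x) = 0"
proof -
  let ?n = "real CARD('n)"
  define V where "V i x = (\<Sum>j\<in>UNIV. a i j x * G j x)" for i x
  define E where "E x = (\<Sum>i\<in>UNIV. G i x * V i x)" for x
  define F where "F x = (\<Sum>i\<in>UNIV. dV i x)" for x
  define c where "c = K\<^sup>2 * (64 * \<bar>\<Lambda>\<bar> * ?n\<^sup>2)"
  define C where "C = 4 * unit_ball_vol ?n * c"
  define ind where "ind R x = (indicator (cball 0 R) x :: real)" for R and x :: "real^'n"
  define e where "e R = (LINT x|lborel. ind R x * E x)" for R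
  define m where "m R = (LINT x|lborel. ind R x * (\<phi> x * F x))" for R
  note cont [continuous_intros] = a_cont \<phi>_cont G_cont dV_cont
  have V_cont [continuous_intros]: "continuous_on UNIV (V i)" for i
    unfolding V_def by (intro continuous_intros)
  have E_cont [continuous_intros]: "continuous_on UNIV E" unfolding E_def by (intro continuous_intros)
  have F_cont [continuous_intros]: "continuous_on UNIV F" unfolding F_def by (intro continuous_intros)
  have E_nonneg: "0 \<le> E x" for x
    using psd[of x "\<lambda>i. G i x"] unfolding E_def V_def by (simp add: sum_distrib_left algebra_simps)
  have \<phi>F: "0 \<le> \<phi> x * F x" for x using sgn unfolding F_def .
  have int_ind: "integrable lborel (\<lambda>x. ind R x * f x)" if "continuous_on UNIV f" for R f
    using borel_integrable_compact[of "cball 0 R" f] continuous_on_subset[OF that]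
    unfolding ind_def by simp
  have int_ind1: "integrable lborel (ind R)" for R
    using int_ind[of "\<lambda>_. 1"] by simp
  have c_nonneg: "0 \<le> c" unfolding c_def by simp
  have vol: "c / R\<^sup>2 * (LINT x|lborel. ind (2 * R) x) \<le> C" if R: "R \<ge> 1" for R
  proof -
    have "(LINT x|lborel. ind (2 * R) x) = measure lborel (cball (0::real^'n) (2 * R))"
      unfolding ind_def by simp
    also have "\<dots> = unit_ball_vol ?n * (2 * R) ^ CARD('n)"
      using R content_cball[of "2 * R" "0::real^'n"] by simp
    also have "\<dots> \<le> unit_ball_vol ?n * (2 * R) ^ 2"
      by (intro mult_left_mono power_increasing unit_ball_vol_nonneg) (use R dim in auto)
    finally have "c / R\<^sup>2 * (LINT x|lborel. ind (2 * R) x) \<le> c / R\<^sup>2 * (unit_ball_vol ?n * (2 * R) ^ 2)"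
      using c_nonneg by (intro mult_left_mono) auto
    also have "\<dots> = C" unfolding C_def using R by (simp add: field_simps)
    finally show ?thesis .
  qed
  \<comment> \<open>The function \<open>d\<close> is the divergence of $z\phi\, a\nabla\phi$. The last two clauses
    compare it with \<open>z * (\<phi> * F + E)\<close>: there is equality where $z$ is constant $1$, and elsewhere the cross
    term is absorbed by Young's inequality with a free parameter \<open>l\<close>.\<close>
  have cut: "\<exists>z d. (\<forall>x. 0 \<le> z x \<and> z x \<le> 1) \<and> (\<forall>x. norm x \<le> R \<longrightarrow> z x = 1) \<and> (\<forall>x. norm x \<ge> 2 * R \<longrightarrow> z x = 0)
      \<and> continuous_on UNIV d \<and> (\<forall>x. norm x \<ge> 2 * R \<longrightarrow> d x = 0)
      \<and> (LINT x|lborel. d x) = 0 \<and> (\<forall>x. norm x \<le> R \<longrightarrow> z x * (\<phi> x * F x + E x) = d x)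
      \<and> (\<forall>x l. l > 0 \<longrightarrow> z x * (\<phi> x * F x + E x) \<le> d x + z x * E x / l + l * (c / R\<^sup>2) * ind (2 * R) x)"
    if R: "R \<ge> 1" for R
  proof -
    define sig where "sig x = 1 - (max 0 (x \<bullet> x / R\<^sup>2 - 1))\<^sup>2" for x :: "real^'n"
    define S where "S i x = - (4 * x $ i / R\<^sup>2) * max 0 (x \<bullet> x / R\<^sup>2 - 1)" for i :: 'n and x :: "real^'n"
    define \<eta> where "\<eta> x = max 0 (sig x)" for x
    define z where "z x = (\<eta> x)\<^sup>2" for x
    define d where "d x = z x * (\<phi> x * F x + E x) + 2 * \<eta> x * \<phi> x * (\<Sum>i\<in>UNIV. S i x * V i x)" for x
    define f' where "f' i x = z x * \<phi> x * dV i x + (2 * \<eta> x * S i x * \<phi> x + z x * G i x) * V i x" for i x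
    have [continuous_intros]: "continuous_on UNIV sig" "continuous_on UNIV (S i)" "continuous_on UNIV \<eta>" 
        "continuous_on UNIV z" for i
      unfolding z_def \<eta>_def sig_def S_def by (intro continuous_intros; use R in simp)+
    have f'_cont [continuous_intros]: "continuous_on UNIV (f' i)" for i
      unfolding f'_def by (intro continuous_intros)
    have d_cont: "continuous_on UNIV d"
      unfolding d_def by (intro continuous_intros)
    have sq: "x \<bullet> x = (norm x)\<^sup>2" for x :: "real^'n" by (simp add: power2_norm_eq_inner)
    have inner: "max 0 (x \<bullet> x / R\<^sup>2 - 1) = 0" if "norm x \<le> R" for x :: "real^'n"
      using that R power_mono[of "norm x" R 2] by (simp add: sq max_def divide_le_eq)
    have outer: "\<eta> x = 0" if "norm x \<ge> 2 * R" for x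
    proof -
      have "(2 * R)\<^sup>2 \<le> (norm x)\<^sup>2" using that R by (intro power_mono) auto
      hence "3 \<le> x \<bullet> x / R\<^sup>2 - 1" using R by (simp add: sq field_simps)
      hence "1 \<le> max 0 (x \<bullet> x / R\<^sup>2 - 1)" by simp
      hence "1 \<le> (max 0 (x \<bullet> x / R\<^sup>2 - 1))\<^sup>2" by (simp add: one_le_power)
      thus ?thesis unfolding \<eta>_def sig_def by simp
    qed
    have \<eta>01: "0 \<le> \<eta> x" "\<eta> x \<le> 1" for x unfolding \<eta>_def sig_def by auto
    have z01: "0 \<le> z x" "z x \<le> 1" for x unfolding z_def using \<eta>01[of x] by (auto intro: power_le_one)
    have z1: "z x = 1" if "norm x \<le> R" for x
      using inner[OF that] unfolding z_def \<eta>_def sig_def by simp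
    have S0: "S i x = 0" if "norm x \<le> R" for x i using inner[OF that] unfolding S_def by simp
    have sig_deriv: "((\<lambda>s. sig (x + s *\<^sub>R axis i 1)) has_real_derivative S i x) (at 0)" for i x
    proof -
      have "((\<lambda>s. (x + s *\<^sub>R axis i 1) \<bullet> (x + s *\<^sub>R axis i 1) / R\<^sup>2 - 1) has_real_derivative 2 * x $ i / R\<^sup>2) (at 0)"
        using DERIV_diff[OF DERIV_cdivide[OF has_real_derivative_sq_norm_line[of x i], of "R\<^sup>2"] DERIV_const[of 1]]
        by simp
      from DERIV_diff[OF DERIV_const[of 1] has_real_derivative_max_0_sq[OF this]] show ?thesis
        unfolding sig_def S_def by (simp add: mult_ac)
    qed
    have z_deriv: "((\<lambda>s. z (x + s *\<^sub>R axis i 1)) has_real_derivative 2 * \<eta> x * S i x) (at 0)" for i x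
      using has_real_derivative_max_0_sq[OF sig_deriv[of x i]] unfolding z_def \<eta>_def by simp
    have f'_int: "(LINT x|lborel. f' i x) = 0" for i
    proof (rule integral_directional_derivative_eq_0[where f = "\<lambda>x. z x * \<phi> x * V i x" and e = "axis i 1" and R = "2 * R"])
      show "((\<lambda>s. z (x + s *\<^sub>R axis i 1) * \<phi> (x + s *\<^sub>R axis i 1) * V i (x + s *\<^sub>R axis i 1)) has_real_derivative f' i x) (at 0)" for x
        unfolding f'_def
        by (rule derivative_eq_intros z_deriv \<phi>_deriv V_deriv[folded V_def] refl)+ (simp add: algebra_simps)
      show "continuous_on UNIV (\<lambda>x. z x * \<phi> x * V i x)" by (intro continuous_intros)
      show "z x * \<phi> x * V i x = 0" if "2 * R \<le> norm x" for x
        using outer[OF that] by (simp add: z_def)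
    qed (rule f'_cont)
    have f'_integrable: "integrable lborel (f' i)" for i
      by (rule integrable_compact_support[OF f'_cont, of "2 * R"]) (simp add: f'_def z_def outer)
    have d_eq: "d x = (\<Sum>i\<in>UNIV. f' i x)" for x
      unfolding d_def f'_def E_def F_def by (simp add: sum.distrib sum_distrib_left algebra_simps)
    have d_int: "(LINT x|lborel. d x) = 0"
      unfolding d_eq using f'_int f'_integrable by simp
    have d0: "d x = 0" if "norm x \<ge> 2 * R" for x
      using outer[OF that] by (simp add: d_def z_def)
    have d1: "z x * (\<phi> x * F x + E x) = d x" if "norm x \<le> R" for x
      unfolding d_def using S0[OF that] by simp
    have young: "z x * (\<phi> x * F x + E x) \<le> d x + z x * E x / l + l * (c / R\<^sup>2) * ind (2 * R) x"
      if l: "l > 0" for x l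
    proof (cases "\<eta> x = 0")
      case True
      thus ?thesis unfolding d_def z_def using c_nonneg l by (simp add: ind_def)
    next
      case False
      hence x2: "norm x \<le> 2 * R" using outer[of x] by linarith
      have pos: "sig x > 0" using False unfolding \<eta>_def by (auto simp: max_def split: if_splits)
      have "max 0 (x \<bullet> x / R\<^sup>2 - 1) \<le> 1"
      proof (rule power2_le_imp_le)
        show "(max 0 (x \<bullet> x / R\<^sup>2 - 1))\<^sup>2 \<le> 1\<^sup>2" using pos unfolding sig_def by simp
      qed simp
      hence Sb: "\<bar>S i x\<bar> \<le> 8 / R" for i
      proof -
        assume m: "max 0 (x \<bullet> x / R\<^sup>2 - 1) \<le> 1"
        have "\<bar>S i x\<bar> = (4 * \<bar>x $ i\<bar> / R\<^sup>2) * max 0 (x \<bullet> x / R\<^sup>2 - 1)"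
          unfolding S_def by (simp add: abs_mult)
        also have "\<dots> \<le> (4 * \<bar>x $ i\<bar> / R\<^sup>2) * 1" using m by (intro mult_left_mono) auto
        also have "\<dots> \<le> (4 * (2 * R) / R\<^sup>2) * 1"
          using component_le_norm_cart[of x i] x2 by (intro mult_right_mono divide_right_mono) auto
        also have "\<dots> = 8 / R" using R by (simp add: power2_eq_square)
        finally show ?thesis .
      qed
      have SS: "(\<Sum>i\<in>UNIV. S i x * (\<Sum>j\<in>UNIV. a i j x * S j x)) \<le> 64 * \<bar>\<Lambda>\<bar> * ?n\<^sup>2 / R\<^sup>2"
      proof -
        have "S i x * (a i j x * S j x) \<le> 64 * \<bar>\<Lambda>\<bar> / R\<^sup>2" for i j
        proof -
          have "S i x * (a i j x * S j x) \<le> \<bar>S i x\<bar> * (\<bar>a i j x\<bar> * \<bar>S j x\<bar>)"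
            by (metis abs_ge_self abs_mult)
          also have "\<dots> \<le> (8 / R) * (\<bar>\<Lambda>\<bar> * (8 / R))"
            using Sb bnd[of i j x] R by (intro mult_mono) auto
          finally show ?thesis by (simp add: power2_eq_square algebra_simps)
        qed
        hence "(\<Sum>i\<in>UNIV. S i x * (\<Sum>j\<in>UNIV. a i j x * S j x)) \<le> (\<Sum>i\<in>(UNIV::'n set). \<Sum>j\<in>(UNIV::'n set). 64 * \<bar>\<Lambda>\<bar> / R\<^sup>2)"
          unfolding sum_distrib_left by (intro sum_mono)
        also have "\<dots> = 64 * \<bar>\<Lambda>\<bar> * ?n\<^sup>2 / R\<^sup>2" by (simp add: power2_eq_square)
        finally show ?thesis .
      qed
      have "- (2 * \<eta> x * \<phi> x * (\<Sum>i\<in>UNIV. S i x * V i x)) \<le> (\<eta> x)\<^sup>2 * E x / l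
         + l * (\<phi> x)\<^sup>2 * (\<Sum>i\<in>UNIV. S i x * (\<Sum>j\<in>UNIV. a i j x * S j x))"
        unfolding E_def V_def by (rule quadratic_form_young[OF sym psd l])
      also have "l * (\<phi> x)\<^sup>2 * (\<Sum>i\<in>UNIV. S i x * (\<Sum>j\<in>UNIV. a i j x * S j x))
          \<le> l * (\<phi> x)\<^sup>2 * (64 * \<bar>\<Lambda>\<bar> * ?n\<^sup>2 / R\<^sup>2)"
        using SS l by (intro mult_left_mono) auto
      also have "\<dots> \<le> l * K\<^sup>2 * (64 * \<bar>\<Lambda>\<bar> * ?n\<^sup>2 / R\<^sup>2)"
        using l \<phi>_bnd[of x] by (intro mult_right_mono mult_left_mono) (auto simp: abs_le_square_iff[symmetric])
      also have "\<dots> = l * (c / R\<^sup>2) * ind (2 * R) x"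
        using x2 by (simp add: c_def ind_def)
      finally show ?thesis unfolding d_def z_def by simp
    qed
    show ?thesis
      by (rule exI[of _ z], rule exI[of _ d])
         (use z01 z1 d_cont d_int d0 d1 young outer in \<open>auto simp: z_def\<close>)
  qed
  \<comment> \<open>With \<open>l = 2\<close> half of the energy is absorbed on the left-hand side.\<close>
  have e_bound: "e R \<le> 4 * C" if R: "R \<ge> 1" for R
  proof -
    obtain z d where z: "\<And>x. 0 \<le> z x \<and> z x \<le> 1" "\<And>x. norm x \<le> R \<Longrightarrow> z x = 1" "\<And>x. norm x \<ge> 2 * R \<Longrightarrow> z x = 0"
      and d: "continuous_on UNIV d" "\<And>x. norm x \<ge> 2 * R \<Longrightarrow> d x = 0" "(LINT x|lborel. d x) = 0"
      and y: "\<And>x l. l > 0 \<Longrightarrow> z x * (\<phi> x * F x + E x) \<le> d x + z x * E x / l + l * (c / R\<^sup>2) * ind (2 * R) x"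
      using cut[OF R] by (elim exE conjE) (rule that; blast)
    have id: "integrable lborel d" using integrable_compact_support[OF d(1,2)] .
    have "e R \<le> (LINT x|lborel. 2 * d x + 4 * (c / R\<^sup>2) * ind (2 * R) x)"
      unfolding e_def
    proof (rule integral_mono)
      fix x
      have "ind R x * E x \<le> z x * E x"
        using z E_nonneg[of x] by (auto simp: ind_def indicator_def)
      moreover have "z x * (\<phi> x * F x) \<ge> 0" using z \<phi>F by simp
      moreover have "z x * (\<phi> x * F x + E x) \<le> d x + z x * E x / 2 + 2 * (c / R\<^sup>2) * ind (2 * R) x"
        by (rule y) simp
      ultimately show "ind R x * E x \<le> 2 * d x + 4 * (c / R\<^sup>2) * ind (2 * R) x"
        by (simp add: distrib_left)
    qed (use id int_ind1 int_ind[OF E_cont] in auto)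
    also have "\<dots> = 4 * (c / R\<^sup>2 * (LINT x|lborel. ind (2 * R) x))"
      using id int_ind1 d(3) by simp
    also have "\<dots> \<le> 4 * C" using vol[OF R] by simp
    finally show ?thesis .
  qed
  \<comment> \<open>The gradient of the cut-off vanishes on the ball of radius \<open>R\<close>, so the energy enters
    only through the annulus. A small \<open>l\<close> makes the second term small, then a large \<open>R\<close> the first.\<close>
  have m_bound: "m R \<le> (e (2 * R) - e R) / l + l * C" if R: "R \<ge> 1" and l: "l > 0" for R l
  proof -
    obtain z d where z: "\<And>x. 0 \<le> z x \<and> z x \<le> 1" "\<And>x. norm x \<le> R \<Longrightarrow> z x = 1" "\<And>x. norm x \<ge> 2 * R \<Longrightarrow> z x = 0"
      and d: "continuous_on UNIV d" "\<And>x. norm x \<ge> 2 * R \<Longrightarrow> d x = 0" "(LINT x|lborel. d x) = 0"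
      and d1: "\<And>x. norm x \<le> R \<Longrightarrow> z x * (\<phi> x * F x + E x) = d x"
      and y: "\<And>x l. l > 0 \<Longrightarrow> z x * (\<phi> x * F x + E x) \<le> d x + z x * E x / l + l * (c / R\<^sup>2) * ind (2 * R) x"
      using cut[OF R] by (elim exE conjE) (rule that; blast)
    have id: "integrable lborel d" using integrable_compact_support[OF d(1,2)] .
    have "m R \<le> (LINT x|lborel. d x + (ind (2 * R) x * E x - ind R x * E x) / l + l * (c / R\<^sup>2) * ind (2 * R) x)"
      unfolding m_def
    proof (rule integral_mono)
      fix x
      have zE: "0 \<le> z x * E x" "0 \<le> z x * (\<phi> x * F x)" using z E_nonneg \<phi>F by simp_all
      have c0: "0 \<le> l * (c / R\<^sup>2) * ind (2 * R) x" using l c_nonneg by (simp add: ind_def)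
      consider "norm x \<le> R" | "R < norm x" "norm x \<le> 2 * R" | "norm x > 2 * R" by linarith
      thus "ind R x * (\<phi> x * F x) \<le> d x + (ind (2 * R) x * E x - ind R x * E x) / l + l * (c / R\<^sup>2) * ind (2 * R) x"
      proof cases
        case 1
        thus ?thesis using d1[OF 1] z(2)[OF 1] E_nonneg[of x] R c0 by (simp add: ind_def)
      next
        case 2
        have "z x * E x / l \<le> E x / l"
          using z E_nonneg[of x] l by (intro divide_right_mono) (auto simp: mult_left_le_one_le)
        hence "0 \<le> d x + E x / l + l * (c / R\<^sup>2) * ind (2 * R) x"
          using y[OF l, of x] zE by (simp add: distrib_left)
        thus ?thesis using 2 by (simp add: ind_def)
      next
        case 3
        thus ?thesis using d(2)[of x] R by (simp add: ind_def)
      qed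
    qed (use id int_ind1 int_ind[OF E_cont] int_ind[of "\<lambda>x. \<phi> x * F x"] \<phi>_cont F_cont in \<open>auto intro!: continuous_intros\<close>)
    also have "\<dots> = (e (2 * R) - e R) / l + l * (c / R\<^sup>2 * (LINT x|lborel. ind (2 * R) x))"
      using id int_ind1 int_ind[OF E_cont] d(3) by (simp add: e_def)
    also have "\<dots> \<le> (e (2 * R) - e R) / l + l * C"
      by (intro add_left_mono mult_left_mono vol[OF R]) (use l in simp)
    finally show ?thesis .
  qed
  have int_\<phi>F: "integrable lborel (\<lambda>x. ind R x * (\<phi> x * F x))" for R
    by (rule int_ind) (intro continuous_intros)
  have mono: "e R \<le> e R'" "m R \<le> m R'" if "R \<le> R'" for R R'
  proof -
    have "ind R x \<le> ind R' x" for x using that by (simp add: ind_def indicator_def)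
    thus "e R \<le> e R'" "m R \<le> m R'"
      unfolding e_def m_def
      by (auto intro!: integral_mono int_ind[OF E_cont] int_\<phi>F mult_right_mono E_nonneg \<phi>F)
  qed
  \<comment> \<open>Along powers of $2$ the energies of the annuli are the increments of a bounded increasing
    sequence.\<close>
  have "incseq (\<lambda>k. e (2 ^ k))"
    by (intro incseq_SucI mono) simp
  moreover have "\<forall>k. e (2 ^ k) \<le> 4 * C" using e_bound by simp
  ultimately obtain L where L: "(\<lambda>k. e (2 ^ k)) \<longlonglongrightarrow> L" by (rule incseq_convergent)
  have m_le: "m (2 ^ k) \<le> l * C" if l: "l > 0" for k l
  proof -
    have "(\<lambda>j. (e (2 ^ Suc j) - e (2 ^ j)) / l + l * C) \<longlonglongrightarrow> (L - L) / l + l * C"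
      by (intro tendsto_intros LIMSEQ_Suc[OF L] L) (use l in auto)
    moreover have "\<forall>j\<ge>k. m (2 ^ k) \<le> (e (2 ^ Suc j) - e (2 ^ j)) / l + l * C"
    proof (intro allI impI)
      fix j assume "k \<le> j"
      hence "m (2 ^ k) \<le> m (2 ^ j)" by (intro mono power_increasing) auto
      also have "\<dots> \<le> (e (2 * 2 ^ j) - e (2 ^ j)) / l + l * C" by (rule m_bound[OF _ l]) simp
      finally show "m (2 ^ k) \<le> (e (2 ^ Suc j) - e (2 ^ j)) / l + l * C" by simp
    qed
    ultimately show ?thesis using Lim_bounded2 by fastforce
  qed
  have m0: "m (2 ^ k) = 0" for k
  proof (rule antisym)
    show "0 \<le> m (2 ^ k)" unfolding m_def using \<phi>F by (intro integral_nonneg_AE) (auto simp: ind_def)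
    have "((\<lambda>l. l * C) \<longlongrightarrow> 0 * C) (at_right 0)" by (intro tendsto_intros)
    moreover have "\<forall>\<^sub>F l in at_right 0. m (2 ^ k) \<le> l * C"
      using m_le eventually_at_right_less[of "0::real"] by (auto elim: eventually_mono)
    ultimately show "m (2 ^ k) \<le> 0" using tendsto_lowerbound[of "\<lambda>l. l * C" "0 * C" "at_right 0"] by simp
  qed
  obtain k where k: "norm x < 2 ^ k" using real_arch_pow[of 2 "norm x"] by auto
  let ?S = "ball 0 (2 ^ k) \<inter> {x. \<phi> x * F x \<noteq> 0}"
  have "AE x in lborel. ind (2 ^ k) x * (\<phi> x * F x) = 0"
    using m0[of k] \<phi>F unfolding m_def
    by (subst (asm) integral_nonneg_eq_0_iff_AE[OF int_\<phi>F]) (auto simp: ind_def)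
  hence "AE x in lebesgue. ind (2 ^ k) x * (\<phi> x * F x) = 0" by (rule AE_completion)
  hence "AE x in lebesgue. x \<notin> ?S" by (rule AE_mp) (auto simp: ind_def indicator_def intro!: AE_I2)
  moreover have "open ?S"
    by (intro open_Int open_ball open_Collect_neq continuous_intros)
  ultimately have "?S = {}" by (intro open_AE_notin_empty)
  thus ?thesis using k unfolding F_def by auto
qed

section \<open>Functions with vanishing sine moments\<close>

text \<open>Differentiating a function of $\mu$ that vanishes on a half-line multiplies the weight by $t - l$.\<close>

lemma integral_weighted_trig_deriv:
  fixes w :: "real \<Rightarrow> real" and T T' :: "real \<Rightarrow> real"
  assumes w: "continuous_on {l..r} w"
    and T: "\<And>y. (T has_real_derivative T' y) (at y)" and T': "continuous_on UNIV T'"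
    and zero: "\<And>\<mu>. \<mu> > c \<Longrightarrow> integral {l..r} (\<lambda>t. w t * T (\<mu> * (t - l))) = 0"
    and \<mu>: "\<mu> > c"
  shows "integral {l..r} (\<lambda>t. w t * (t - l) * T' (\<mu> * (t - l))) = 0"
proof -
  have T_cont: "continuous_on UNIV T"
    using T by (meson DERIV_isCont continuous_at_imp_continuous_on)
  have D: "((\<lambda>\<mu>. integral (cbox l r) (\<lambda>t. w t * T (\<mu> * (t - l)))) has_field_derivative
      integral (cbox l r) (\<lambda>t. w t * (t - l) * T' (\<mu> * (t - l)))) (at \<mu> within UNIV)"
  proof (rule leibniz_rule_field_derivative)
    show "((\<lambda>\<mu>. w t * T (\<mu> * (t - l))) has_field_derivative w t * (t - l) * T' (\<mu> * (t - l))) (at \<mu> within UNIV)" for \<mu> t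
    proof -
      have "((\<lambda>\<mu>. \<mu> * (t - l)) has_real_derivative t - l) (at \<mu>)"
        by (auto intro!: derivative_eq_intros)
      from DERIV_cmult[OF DERIV_chain2[OF T this], of "w t"] show ?thesis by (simp add: mult_ac)
    qed
    show "(\<lambda>t. w t * T (\<mu> * (t - l))) integrable_on cbox l r" for \<mu>
      using w by (auto intro!: integrable_continuous_real continuous_intros continuous_on_compose2[OF T_cont])
    have "continuous_on (UNIV \<times> cbox l r) (\<lambda>z::real\<times>real. w (snd z) * (snd z - l) * T' (fst z * (snd z - l)))"
      by (intro continuous_intros continuous_on_compose2[OF w] continuous_on_compose2[OF T']) auto
    thus "continuous_on (UNIV \<times> cbox l r) (\<lambda>(\<mu>, t). w t * (t - l) * T' (\<mu> * (t - l)))"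
      by (simp add: case_prod_unfold)
  qed auto
  have "((\<lambda>\<mu>. 0::real) has_real_derivative integral (cbox l r) (\<lambda>t. w t * (t - l) * T' (\<mu> * (t - l)))) (at \<mu>)"
    by (rule has_field_derivative_transform_within_open[OF D, of "{c<..}"]) (use zero \<mu> in auto)
  hence "integral (cbox l r) (\<lambda>t. w t * (t - l) * T' (\<mu> * (t - l))) = 0"
    by (rule DERIV_unique) (rule DERIV_const)
  thus ?thesis by simp
qed

text \<open>Polynomials in $(t - l)^2$ are dense on $[l, r]$ by the Weierstrass theorem in the variable
$s = (t - l)^2$, so $H$ is orthogonal to itself.\<close>

lemma even_moments_zero_imp_zero:
  fixes H :: "real \<Rightarrow> real"
  assumes lr: "l < r" and H: "continuous_on {l..r} H"
    and mom: "\<And>k. integral {l..r} (\<lambda>t. H t * ((t - l)\<^sup>2) ^ k) = 0"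
    and t: "t \<in> {l..r}"
  shows "H t = 0"
proof -
  define f where "f s = H (l + sqrt s)" for s
  let ?S = "{0..(r - l)\<^sup>2}"
  have f: "continuous_on ?S f"
    unfolding f_def
  proof (intro continuous_on_compose2[OF H] continuous_intros)
    show "(\<lambda>s. l + sqrt s) ` ?S \<subseteq> {l..r}"
    proof safe
      fix s assume "s \<in> ?S"
      hence "sqrt s \<le> r - l" "0 \<le> s" using lr by (auto intro: real_le_lsqrt)
      thus "l + sqrt s \<in> {l..r}" by simp
    qed
  qed
  have int: "integral {l..r} (\<lambda>t. H t * H t) \<le> e * integral {l..r} (\<lambda>t. \<bar>H t\<bar>)" if "e > 0" for e
  proof -
    obtain p where p: "real_polynomial_function p" "\<And>s. s \<in> ?S \<Longrightarrow> \<bar>f s - p s\<bar> < e"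
      using Stone_Weierstrass_real_polynomial_function[OF _ f \<open>e > 0\<close>] by auto
    then obtain c n where pc: "p = (\<lambda>s. \<Sum>i\<le>n. c i * s ^ i)"
      unfolding real_polynomial_function_iff_sum by blast
    have "integral {l..r} (\<lambda>t. H t * p ((t - l)\<^sup>2)) = integral {l..r} (\<lambda>t. \<Sum>i\<le>n. c i * (H t * ((t - l)\<^sup>2) ^ i))"
      unfolding pc by (simp add: sum_distrib_left mult_ac)
    also have "\<dots> = (\<Sum>i\<le>n. integral {l..r} (\<lambda>t. c i * (H t * ((t - l)\<^sup>2) ^ i)))"
      by (intro integral_sum integrable_continuous_real continuous_intros H) auto
    also have "\<dots> = 0" using mom by simp
    finally have p0: "integral {l..r} (\<lambda>t. H t * p ((t - l)\<^sup>2)) = 0" .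
    have pcont: "continuous_on {l..r} (\<lambda>t. H t * p ((t - l)\<^sup>2))"
      unfolding pc by (intro continuous_intros H)
    have "integral {l..r} (\<lambda>t. H t * H t) = integral {l..r} (\<lambda>t. H t * H t - H t * p ((t - l)\<^sup>2))"
      using p0 by (subst integral_diff) (auto intro!: integrable_continuous_real continuous_intros H pcont)
    also have "\<dots> \<le> integral {l..r} (\<lambda>t. e * \<bar>H t\<bar>)"
    proof (rule integral_le)
      fix t assume t: "t \<in> {l..r}"
      have f_sq: "f ((t - l)\<^sup>2) = H t" using t by (simp add: f_def)
      have "(t - l)\<^sup>2 \<in> ?S" using t by (auto intro: power_mono)
      from p(2)[OF this] have "\<bar>H t - p ((t - l)\<^sup>2)\<bar> \<le> e" unfolding f_sq by simp
      hence "\<bar>H t\<bar> * \<bar>H t - p ((t - l)\<^sup>2)\<bar> \<le> \<bar>H t\<bar> * e" by (rule mult_left_mono) simp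
      moreover have "H t * (H t - p ((t - l)\<^sup>2)) \<le> \<bar>H t\<bar> * \<bar>H t - p ((t - l)\<^sup>2)\<bar>"
        unfolding abs_mult[symmetric] by (rule abs_ge_self)
      ultimately show "H t * H t - H t * p ((t - l)\<^sup>2) \<le> e * \<bar>H t\<bar>"
        by (simp add: right_diff_distrib mult.commute)
    qed (auto intro!: integrable_continuous_real continuous_intros H pcont)
    finally show ?thesis by simp
  qed
  have "integral {l..r} (\<lambda>t. H t * H t) \<le> 0"
  proof -
    have "((\<lambda>e. e * integral {l..r} (\<lambda>t. \<bar>H t\<bar>)) \<longlongrightarrow> 0 * integral {l..r} (\<lambda>t. \<bar>H t\<bar>)) (at_right 0)"
      by (intro tendsto_intros)
    moreover have "\<forall>\<^sub>F e in at_right 0. integral {l..r} (\<lambda>t. H t * H t) \<le> e * integral {l..r} (\<lambda>t. \<bar>H t\<bar>)"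
      using int eventually_at_right_less[of "0::real"] by (auto elim: eventually_mono)
    ultimately have "integral {l..r} (\<lambda>t. H t * H t) \<le> 0 * integral {l..r} (\<lambda>t. \<bar>H t\<bar>)"
      by (rule tendsto_lowerbound) simp
    thus ?thesis by simp
  qed
  moreover have "integral {l..r} (\<lambda>t. H t * H t) \<ge> 0"
    by (intro integral_nonneg integrable_continuous_real continuous_intros H) auto
  ultimately have "integral {l..r} (\<lambda>t. H t * H t) = 0" by simp
  thus ?thesis
    using integral_eq_0_iff[OF continuous_on_mult[OF H H] lr] t by simp
qed

text \<open>Differentiating $2k$ times in $\mu$ shows that all even moments of
$h(t) \sin(\mu (t - l))$ vanish, hence so does this function, for every $\mu > c$. It remains to
choose $\mu$ such that the sine is $1$ at the given point. Since the frequencies vary continuously, only large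
ones are required, which is what the sign condition in the Liouville theorem provides.\<close>

lemma sine_moments_zero_imp_zero:
  fixes h :: "real \<Rightarrow> real"
  assumes lr: "l < r" and h: "continuous_on {l..r} h"
    and zero: "\<And>\<mu>. \<mu> > c \<Longrightarrow> integral {l..r} (\<lambda>t. h t * sin (\<mu> * (t - l))) = 0"
    and t: "t \<in> {l<..r}"
  shows "h t = 0"
proof -
  have mom: "integral {l..r} (\<lambda>t. (h t * ((t - l)\<^sup>2) ^ k) * sin (\<mu> * (t - l))) = 0" if "\<mu> > c" for k \<mu>
    using that
  proof (induction k arbitrary: \<mu>)
    case 0
    thus ?case using zero by simp
  next
    case (Suc k)
    let ?w = "\<lambda>t. h t * ((t - l)\<^sup>2) ^ k"
    have w: "continuous_on {l..r} ?w" by (intro continuous_intros h)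
    have cos0: "integral {l..r} (\<lambda>t. ?w t * (t - l) * cos (\<mu> * (t - l))) = 0" if "\<mu> > c" for \<mu>
      by (rule integral_weighted_trig_deriv[OF w DERIV_sin _ Suc.IH that]) (auto intro: continuous_intros)
    have "integral {l..r} (\<lambda>t. ?w t * (t - l) * (t - l) * (- sin (\<mu> * (t - l)))) = 0"
      by (rule integral_weighted_trig_deriv[where w = "\<lambda>t. ?w t * (t - l)" and T' = "\<lambda>y. - sin y",
            OF _ DERIV_cos _ cos0 Suc.prems]) (intro continuous_intros w)+
    thus ?case by (simp add: power2_eq_square mult_ac)
  qed
  obtain n :: nat where n: "\<bar>c\<bar> * (t - l) < real n" using reals_Archimedean2 by blast
  define \<mu> where "\<mu> = (pi / 2 + 2 * pi * real n) / (t - l)"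
  have tl: "t - l > 0" using t by simp
  have "\<bar>c\<bar> * (t - l) < pi / 2 + 2 * pi * real n"
  proof -
    have "1 * real n \<le> 2 * pi * real n" using pi_gt3 by (intro mult_right_mono) auto
    thus ?thesis using n pi_gt_zero by linarith
  qed
  hence \<mu>: "\<mu> > c" unfolding \<mu>_def using tl abs_ge_self[of c]
    by (metis less_le_trans le_less_trans pos_less_divide_eq)
  have "h t * sin (\<mu> * (t - l)) = 0"
  proof (rule even_moments_zero_imp_zero[OF lr, of "\<lambda>t. h t * sin (\<mu> * (t - l))"])
    show "continuous_on {l..r} (\<lambda>t. h t * sin (\<mu> * (t - l)))" by (intro continuous_intros h)
    show "integral {l..r} (\<lambda>t. h t * sin (\<mu> * (t - l)) * ((t - l)\<^sup>2) ^ k) = 0" for k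
      using mom[OF \<mu>, of k] by (simp add: mult_ac)
  qed (use t in auto)
  moreover have "sin (\<mu> * (t - l)) = 1"
  proof -
    have "\<mu> * (t - l) = pi / 2 + 2 * real n * pi" unfolding \<mu>_def using tl by simp
    thus ?thesis by (simp add: sin_add)
  qed
  ultimately show ?thesis by simp
qed

section \<open>Moments in the normal variable\<close>

lemma continuous_on_compose_half_space:
  assumes "continuous_on (UNIV \<times> {0..}) (\<lambda>(x, t). f x t)"
    and "continuous_on S p" "continuous_on S q" "\<And>z. z \<in> S \<Longrightarrow> (0::real) \<le> q z"
  shows "continuous_on S (\<lambda>z. f (p z) (q z))"
  using continuous_on_compose2[OF assms(1) continuous_on_Pair[OF assms(2,3)]] assms(4) by auto

text \<open>A tangential derivative that extends continuously to $t = 0$ is the derivative of the boundary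
slice. For $t > 0$ the slice is the integral of $f'$; both sides of this identity are continuous in $t$.\<close>

lemma slice_derivative_up_to_boundary:
  fixes f f' :: "'a::real_normed_vector \<Rightarrow> real \<Rightarrow> real"
  assumes f: "continuous_on (UNIV \<times> {0..}) (\<lambda>(x, t). f x t)"
    and f': "continuous_on (UNIV \<times> {0..}) (\<lambda>(x, t). f' x t)"
    and D: "\<And>x t. t > 0 \<Longrightarrow> ((\<lambda>s. f (x + s *\<^sub>R e) t) has_real_derivative f' x t) (at 0)"
    and t: "t \<ge> 0"
  shows "((\<lambda>s. f (x + s *\<^sub>R e) t) has_real_derivative f' x t) (at 0)"
proof -
  have interior: "f (x + s *\<^sub>R e) \<tau> = f (x - e) \<tau> + integral {-1..s} (\<lambda>r. f' (x + r *\<^sub>R e) \<tau>)"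
    if s: "s \<in> {-1..1}" and \<tau>: "\<tau> > 0" for s \<tau>
  proof -
    have "((\<lambda>r. f' (x + r *\<^sub>R e) \<tau>) has_integral f (x + s *\<^sub>R e) \<tau> - f (x + (-1) *\<^sub>R e) \<tau>) {-1..s}"
    proof (rule fundamental_theorem_of_calculus)
      show "((\<lambda>s. f (x + s *\<^sub>R e) \<tau>) has_vector_derivative f' (x + r *\<^sub>R e) \<tau>) (at r within {-1..s})" for r
        using has_real_derivative_shift_line[of "\<lambda>x. f x \<tau>" e "\<lambda>x. f' x \<tau>" x r, OF D[OF \<tau>]]
        by (simp add: has_real_derivative_iff_has_vector_derivative has_vector_derivative_at_within)
    qed (use s in auto)
    thus ?thesis by (simp add: integral_unique)
  qed
  have FTC: "f (x + s *\<^sub>R e) t = f (x - e) t + integral {-1..s} (\<lambda>r. f' (x + r *\<^sub>R e) t)"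
    if s: "s \<in> {-1..1}" for s
  proof (cases "t > 0")
    case True
    thus ?thesis by (rule interior[OF s])
  next
    case False
    have t0: "t = 0" using False t by simp
    define \<Delta> where "\<Delta> \<tau> = f (x + s *\<^sub>R e) \<tau> - f (x - e) \<tau> - integral (cbox (-1) s) (\<lambda>r. f' (x + r *\<^sub>R e) \<tau>)" for \<tau>
    have fc: "continuous_on {0..1} (\<lambda>\<tau>. f y \<tau>)" for y
      by (intro continuous_on_compose_half_space[OF f] continuous_intros) auto
    have "continuous_on ({0..1} \<times> cbox (-1) s) (\<lambda>(\<tau>, r). f' (x + r *\<^sub>R e) \<tau>)"
      unfolding case_prod_unfold
      by (intro continuous_on_compose_half_space[OF f'] continuous_intros) auto
    hence "continuous_on {0..1} (\<lambda>\<tau>. integral (cbox (-1) s) (\<lambda>r. f' (x + r *\<^sub>R e) \<tau>))"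
      by (rule integral_continuous_on_param)
    hence cont: "continuous_on (closure {0<..<1}) \<Delta>"
      unfolding \<Delta>_def by (simp, intro continuous_intros fc)
    have "\<Delta> \<tau> = 0" if "\<tau> \<in> {0<..<1}" for \<tau>
      using interior[OF s, of \<tau>] that by (simp add: \<Delta>_def)
    hence "\<Delta> 0 = 0" using continuous_constant_on_closure[OF cont, of 0 0] by simp
    thus ?thesis using t0 by (simp add: \<Delta>_def)
  qed
  have "continuous_on {-1..1} (\<lambda>r. f' (x + r *\<^sub>R e) t)"
    using t by (intro continuous_on_compose_half_space[OF f'] continuous_intros) auto
  hence "((\<lambda>s. integral {-1..s} (\<lambda>r. f' (x + r *\<^sub>R e) t)) has_real_derivative f' (x + 0 *\<^sub>R e) t) (at 0 within {-1..1})"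
    by (rule integral_has_real_derivative) simp
  hence "((\<lambda>s. integral {-1..s} (\<lambda>r. f' (x + r *\<^sub>R e) t)) has_real_derivative f' x t) (at 0)"
    by (simp add: at_within_interior[of 0 "{-1..1::real}"])
  hence "((\<lambda>s. f (x - e) t + integral {-1..s} (\<lambda>r. f' (x + r *\<^sub>R e) t)) has_real_derivative f' x t) (at 0)"
    by (auto intro!: derivative_eq_intros)
  thus ?thesis
    by (rule has_field_derivative_transform_within_open[where S = "{-1<..<1}"]) (use FTC in auto)
qed

lemma slice_moment_derivative:
  fixes f f' :: "'a::real_normed_vector \<Rightarrow> real \<Rightarrow> real"
  assumes f: "continuous_on (UNIV \<times> {0..}) (\<lambda>(x, t). f x t)"
    and f': "continuous_on (UNIV \<times> {0..}) (\<lambda>(x, t). f' x t)"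
    and D: "\<And>x t. t \<ge> 0 \<Longrightarrow> ((\<lambda>s. f (x + s *\<^sub>R e) t) has_real_derivative f' x t) (at 0)"
    and l: "0 \<le> l" and g: "continuous_on {l..r} g"
  shows "((\<lambda>s. integral {l..r} (\<lambda>t. f (x + s *\<^sub>R e) t * g t)) has_real_derivative
      integral {l..r} (\<lambda>t. f' x t * g t)) (at 0)"
proof -
  have "((\<lambda>s. integral (cbox l r) (\<lambda>t. f (x + s *\<^sub>R e) t * g t)) has_field_derivative
      integral (cbox l r) (\<lambda>t. f' (x + 0 *\<^sub>R e) t * g t)) (at 0 within UNIV)"
  proof (rule leibniz_rule_field_derivative)
    show "((\<lambda>s. f (x + s *\<^sub>R e) t * g t) has_field_derivative f' (x + s *\<^sub>R e) t * g t) (at s within UNIV)"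
      if "t \<in> cbox l r" for s t
      using has_real_derivative_shift_line[of "\<lambda>x. f x t" e "\<lambda>x. f' x t" x s, OF D] that l
      by (auto intro!: derivative_eq_intros)
    show "(\<lambda>t. f (x + s *\<^sub>R e) t * g t) integrable_on cbox l r" for s
      unfolding interval_cbox[symmetric] using l
      by (intro integrable_continuous_real continuous_on_mult g continuous_on_compose_half_space[OF f] continuous_intros) auto
    show "continuous_on (UNIV \<times> cbox l r) (\<lambda>(s, t). f' (x + s *\<^sub>R e) t * g t)"
      unfolding case_prod_unfold using l
      by (intro continuous_on_mult continuous_on_compose_half_space[OF f'] continuous_on_compose2[OF g]
          continuous_intros) auto
  qed auto
  thus ?thesis by simp
qed

lemma slice_moment_continuous:
  fixes f :: "'a::real_normed_vector \<Rightarrow> real \<Rightarrow> real"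
  assumes f: "continuous_on (UNIV \<times> {0..}) (\<lambda>(x, t). f x t)"
    and l: "0 \<le> l" and g: "continuous_on {l..r} g"
  shows "continuous_on UNIV (\<lambda>x. integral {l..r} (\<lambda>t. f x t * g t))"
proof -
  have "continuous_on (UNIV \<times> cbox l r) (\<lambda>(x, t). f x t * g t)"
    unfolding case_prod_unfold using l
    by (intro continuous_on_mult continuous_on_compose_half_space[OF f] continuous_on_compose2[OF g]
        continuous_intros) auto
  from integral_continuous_on_param[OF this] show ?thesis by simp
qed

section \<open>Uniqueness, one period after the other\<close>

lemma integral_by_parts_twice:
  fixes h g :: "real \<Rightarrow> real"
  assumes lr: "l \<le> r"
    and h: "continuous_on {l..r} h" and h': "continuous_on {l..r} h'" and h'': "continuous_on {l..r} h''"
    and g: "continuous_on {l..r} g" and g': "continuous_on {l..r} g'" and g'': "continuous_on {l..r} g''"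
    and dh: "\<And>t. t \<in> {l<..<r} \<Longrightarrow> (h has_real_derivative h' t) (at t)"
    and dh': "\<And>t. t \<in> {l<..<r} \<Longrightarrow> (h' has_real_derivative h'' t) (at t)"
    and dg: "\<And>t. t \<in> {l<..<r} \<Longrightarrow> (g has_real_derivative g' t) (at t)"
    and dg': "\<And>t. t \<in> {l<..<r} \<Longrightarrow> (g' has_real_derivative g'' t) (at t)"
  shows "integral {l..r} (\<lambda>t. h'' t * g t)
     = h' r * g r - h r * g' r - (h' l * g l - h l * g' l) + integral {l..r} (\<lambda>t. h t * g'' t)"
proof -
  have "((\<lambda>t. h'' t * g t - h t * g'' t) has_integral
      (h' r * g r - h r * g' r) - (h' l * g l - h l * g' l)) {l..r}"
  proof (rule fundamental_theorem_of_calculus_interior[OF lr])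
    show "continuous_on {l..r} (\<lambda>t. h' t * g t - h t * g' t)"
      by (intro continuous_intros assms)
    fix t assume t: "t \<in> {l<..<r}"
    show "((\<lambda>t. h' t * g t - h t * g' t) has_vector_derivative h'' t * g t - h t * g'' t) (at t)"
      unfolding has_real_derivative_iff_has_vector_derivative[symmetric]
      by (rule derivative_eq_intros dh[OF t] dh'[OF t] dg[OF t] dg'[OF t] refl)+ (simp add: algebra_simps)
  qed
  hence "integral {l..r} (\<lambda>t. h'' t * g t - h t * g'' t)
      = (h' r * g r - h r * g' r) - (h' l * g l - h l * g' l)" by (rule integral_unique)
  moreover have "integral {l..r} (\<lambda>t. h'' t * g t - h t * g'' t)
      = integral {l..r} (\<lambda>t. h'' t * g t) - integral {l..r} (\<lambda>t. h t * g'' t)"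
    by (intro integral_diff integrable_continuous_real continuous_on_mult assms)
  ultimately show ?thesis by simp
qed

text \<open>The boundary value problem written with curried functions of $x'$ and $t = x_N$. The
functions \<open>uN\<close>, \<open>uNN\<close>, \<open>uT\<close>, \<open>uTT\<close> are the continuous extensions to $t = 0$ of the normal and tangential
derivatives, so they are tied to \<open>u\<close> for $t > 0$ only.\<close>

locale half_space_solution =
  fixes a da :: "'n::finite \<Rightarrow> 'n \<Rightarrow> real^'n \<Rightarrow> real" and \<Lambda> :: real
    and u uN uNN :: "real^'n \<Rightarrow> real \<Rightarrow> real"
    and uT :: "'n \<Rightarrow> real^'n \<Rightarrow> real \<Rightarrow> real" and uTT :: "'n \<Rightarrow> 'n \<Rightarrow> real^'n \<Rightarrow> real \<Rightarrow> real"
  assumes dim: "CARD('n) \<le> 2"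
    and a_sym: "\<And>i j x. a i j x = a j i x"
    and a_psd: "\<And>x \<xi>. 0 \<le> (\<Sum>i\<in>UNIV. \<Sum>j\<in>UNIV. a i j x * \<xi> i * \<xi> j)"
    and a_bnd: "\<And>i j x. \<bar>a i j x\<bar> \<le> \<Lambda>"
    and a_cont: "\<And>i j. continuous_on UNIV (a i j)"
    and da_cont: "\<And>i j. continuous_on UNIV (da i j)"
    and a_deriv: "\<And>i j x. ((\<lambda>s. a i j (x + s *\<^sub>R axis i 1)) has_real_derivative da i j x) (at 0)"
    and u_cont: "continuous_on (UNIV \<times> {0..}) (\<lambda>(x, t). u x t)"
    and uN_cont: "continuous_on (UNIV \<times> {0..}) (\<lambda>(x, t). uN x t)"
    and uNN_cont: "continuous_on (UNIV \<times> {0..}) (\<lambda>(x, t). uNN x t)"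
    and uT_cont: "\<And>i. continuous_on (UNIV \<times> {0..}) (\<lambda>(x, t). uT i x t)"
    and uTT_cont: "\<And>i j. continuous_on (UNIV \<times> {0..}) (\<lambda>(x, t). uTT i j x t)"
    and uN_deriv: "\<And>x t. t > 0 \<Longrightarrow> (u x has_real_derivative uN x t) (at t)"
    and uNN_deriv: "\<And>x t. t > 0 \<Longrightarrow> (uN x has_real_derivative uNN x t) (at t)"
    and uT_deriv: "\<And>i x t. t > 0 \<Longrightarrow>
          ((\<lambda>s. u (x + s *\<^sub>R axis i 1) t) has_real_derivative uT i x t) (at 0)"
    and uTT_deriv: "\<And>i j x t. t > 0 \<Longrightarrow>
          ((\<lambda>s. uT j (x + s *\<^sub>R axis i 1) t) has_real_derivative uTT i j x t) (at 0)"
    and equation: "\<And>x t. t > 0 \<Longrightarrow>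
          (\<Sum>i\<in>UNIV. \<Sum>j\<in>UNIV. da i j x * uT j x t + a i j x * uTT i j x t) + uNN x t = 1 - u x t"
    and u_zero: "\<And>x. u x 0 = 0"
    and u_nonneg: "\<And>x t. t \<ge> 0 \<Longrightarrow> 0 \<le> u x t"
    and u_bnd: "\<And>M. \<exists>C. \<forall>x. \<forall>t\<in>{0..M}. u x t \<le> C"
begin

definition v :: "real^'n \<Rightarrow> real \<Rightarrow> real" where
  "v x t = u x t - (1 - cos t)"

definition moment :: "real \<Rightarrow> real \<Rightarrow> real \<Rightarrow> real^'n \<Rightarrow> real" where
  "moment \<mu> l r x = integral {l..r} (\<lambda>t. v x t * sin (\<mu> * (t - l)))"

text \<open>The value of $\mathrm{div}(\widehat A\nabla\phi)$ for the moment $\phi$, when $v$ vanishes for $t = l$; it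
contains the boundary terms left by two integrations by parts at $t = r$.\<close>

definition moment_div :: "real \<Rightarrow> real \<Rightarrow> real \<Rightarrow> real^'n \<Rightarrow> real" where
  "moment_div \<mu> l r x = (\<mu>\<^sup>2 - 1) * moment \<mu> l r x
     - (uN x r - sin r) * sin (\<mu> * (r - l)) + v x r * \<mu> * cos (\<mu> * (r - l))"

lemma v_cont: "continuous_on (UNIV \<times> {0..}) (\<lambda>(x, t). v x t)"
  using u_cont unfolding v_def case_prod_unfold by (intro continuous_intros) auto

lemma moment_bounded:
  assumes l: "0 \<le> l" "l \<le> r"
  obtains K where "\<And>x. \<bar>moment \<mu> l r x\<bar> \<le> K"
proof -
  obtain C where C: "\<And>x t. t \<in> {0..r} \<Longrightarrow> u x t \<le> C" using u_bnd[of r] by blast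
  have "\<bar>moment \<mu> l r x\<bar> \<le> (C + 2) * (r - l)" for x
  proof -
    have "norm (integral {l..r} (\<lambda>t. v x t * sin (\<mu> * (t - l)))) \<le> (C + 2) * (r - l)"
    proof (rule integral_bound)
      show "continuous_on {l..r} (\<lambda>t. v x t * sin (\<mu> * (t - l)))"
        using l by (intro continuous_on_mult continuous_on_compose_half_space[OF v_cont] continuous_intros) auto
      fix t assume t: "t \<in> {l..r}"
      have "\<bar>v x t\<bar> \<le> C + 2"
      proof -
        have "0 \<le> u x t" "u x t \<le> C" using C[of t x] u_nonneg[of t x] t l by auto
        thus ?thesis using cos_le_one[of t] cos_ge_minus_one[of t] unfolding v_def by linarith
      qed
      moreover have "\<bar>sin (\<mu> * (t - l))\<bar> \<le> 1" by simp
      ultimately have "\<bar>v x t\<bar> * \<bar>sin (\<mu> * (t - l))\<bar> \<le> (C + 2) * 1"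
        by (intro mult_mono) auto
      thus "norm (v x t * sin (\<mu> * (t - l))) \<le> C + 2" by (simp add: abs_mult)
    qed (use l in auto)
    thus ?thesis unfolding moment_def by simp
  qed
  thus ?thesis using that by blast
qed

text \<open>Differentiation under the integral turns the divergence of $\widehat A\nabla\phi$ into the moment of
$-(v + v_{NN})$. Integrating by parts twice moves the normal derivatives to the sine; the
lower face contributes nothing because both $v$ and the sine vanish there. The constant \<open>k\<close> does not affect
the gradient and can be used to adjust the sign of $\phi$.\<close>

lemma moment_liouville:
  assumes l: "0 \<le> l" "l < r" and v_l: "\<And>x. v x l = 0"
    and sgn: "\<And>x. 0 \<le> (moment \<mu> l r x + k) * moment_div \<mu> l r x"
  shows "(moment \<mu> l r x + k) * moment_div \<mu> l r x = 0"
proof -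
  define g where "g t = sin (\<mu> * (t - l))" for t
  define G where "G i x = integral {l..r} (\<lambda>t. uT i x t * g t)" for i x
  define H where "H i j x = integral {l..r} (\<lambda>t. uTT i j x t * g t)" for i j x
  define dV where "dV i x = (\<Sum>j\<in>UNIV. da i j x * G j x + a i j x * H i j x)" for i x
  have g: "continuous_on {l..r} g" unfolding g_def by (intro continuous_intros)
  have uT_deriv': "((\<lambda>s. u (x + s *\<^sub>R axis i 1) t) has_real_derivative uT i x t) (at 0)" if "t \<ge> 0" for i x t
    by (rule slice_derivative_up_to_boundary[OF u_cont uT_cont uT_deriv that])
  have uTT_deriv': "((\<lambda>s. uT j (x + s *\<^sub>R axis i 1) t) has_real_derivative uTT i j x t) (at 0)" if "t \<ge> 0" for i j x t
    by (rule slice_derivative_up_to_boundary[OF uT_cont uTT_cont uTT_deriv that])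
  have v_deriv: "((\<lambda>s. v (x + s *\<^sub>R axis i 1) t) has_real_derivative uT i x t) (at 0)" if "t \<ge> 0" for i x t
    using DERIV_diff[OF uT_deriv'[OF that] DERIV_const[of "1 - cos t"]] unfolding v_def by simp
  have G_cont: "continuous_on UNIV (G i)" for i
    unfolding G_def by (rule slice_moment_continuous[OF uT_cont l(1) g])
  have H_cont: "continuous_on UNIV (H i j)" for i j
    unfolding H_def by (rule slice_moment_continuous[OF uTT_cont l(1) g])
  have G_deriv: "((\<lambda>s. G j (x + s *\<^sub>R axis i 1)) has_real_derivative H i j x) (at 0)" for i j x
    unfolding G_def H_def by (rule slice_moment_derivative[OF uT_cont uTT_cont uTT_deriv' l(1) g])
  have moment_deriv: "((\<lambda>s. moment \<mu> l r (x + s *\<^sub>R axis i 1) + k) has_real_derivative G i x) (at 0)" for i x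
    using DERIV_add[OF slice_moment_derivative[OF v_cont uT_cont v_deriv l(1) g] DERIV_const[of k], of x i]
    unfolding moment_def G_def g_def[abs_def] by simp
  have slice: "continuous_on {l..r} (f x)"
    if "continuous_on (UNIV \<times> {0..}) (\<lambda>(x, t). f x t)" for f and x :: "real^'n"
    using l by (intro continuous_on_compose_half_space[OF that] continuous_intros) auto
  have sum_dV: "(\<Sum>i\<in>UNIV. dV i x) = moment_div \<mu> l r x" for x
  proof -
    have int: "(\<lambda>t. f x t * g t) integrable_on {l..r}"
      if "continuous_on (UNIV \<times> {0..}) (\<lambda>(x, t). f x t)" for f
      by (intro integrable_continuous_real continuous_on_mult slice[OF that] g)
    have "((\<lambda>t. (da i j x * uT j x t + a i j x * uTT i j x t) * g t) has_integral
        da i j x * G j x + a i j x * H i j x) {l..r}" for i j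
      using has_integral_add[OF has_integral_mult_right[OF integrable_integral[OF int[OF uT_cont]], of "da i j x" j]
          has_integral_mult_right[OF integrable_integral[OF int[OF uTT_cont]], of "a i j x" i j]]
      unfolding G_def H_def by (simp add: distrib_right mult.assoc)
    hence "((\<lambda>t. \<Sum>i\<in>UNIV. \<Sum>j\<in>UNIV. (da i j x * uT j x t + a i j x * uTT i j x t) * g t) has_integral
        (\<Sum>i\<in>UNIV. dV i x)) {l..r}"
      unfolding dV_def by (intro has_integral_sum) auto
    hence "(\<Sum>i\<in>UNIV. dV i x)
        = integral {l..r} (\<lambda>t. \<Sum>i\<in>UNIV. \<Sum>j\<in>UNIV. (da i j x * uT j x t + a i j x * uTT i j x t) * g t)"
      by (rule integral_unique[symmetric])
    also have "\<dots> = integral {l..r} (\<lambda>t. - (v x t * g t) - (uNN x t - cos t) * g t)"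
    \<comment> \<open>The equation is not available at $t = l$ when $l = 0$.\<close>
    proof (rule integral_spike[of "{l}"])
      fix t assume t: "t \<in> {l..r} - {l}"
      hence pde: "(\<Sum>i\<in>UNIV. \<Sum>j\<in>UNIV. da i j x * uT j x t + a i j x * uTT i j x t) = 1 - u x t - uNN x t"
        using equation[of t x] l by auto
      have factor: "(\<Sum>i\<in>UNIV. \<Sum>j\<in>UNIV. (da i j x * uT j x t + a i j x * uTT i j x t) * g t)
          = (\<Sum>i\<in>UNIV. \<Sum>j\<in>UNIV. da i j x * uT j x t + a i j x * uTT i j x t) * g t"
        by (simp add: sum_distrib_right)
      show "- (v x t * g t) - (uNN x t - cos t) * g t
          = (\<Sum>i\<in>UNIV. \<Sum>j\<in>UNIV. (da i j x * uT j x t + a i j x * uTT i j x t) * g t)"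
        unfolding factor pde by (simp add: v_def algebra_simps)
    qed auto
    also have "\<dots> = - integral {l..r} (\<lambda>t. v x t * g t) - integral {l..r} (\<lambda>t. (uNN x t - cos t) * g t)"
      by (subst integral_diff)
         (auto intro!: integrable_continuous_real continuous_intros slice[OF v_cont] slice[OF uNN_cont] g)
    also have "integral {l..r} (\<lambda>t. (uNN x t - cos t) * g t)
       = (uN x r - sin r) * g r - v x r * (\<mu> * cos (\<mu> * (r - l)))
          - ((uN x l - sin l) * g l - v x l * (\<mu> * cos (\<mu> * (l - l))))
          + integral {l..r} (\<lambda>t. v x t * (- (\<mu>\<^sup>2 * g t)))"
    proof (rule integral_by_parts_twice)
      fix t assume "t \<in> {l<..<r}"
      hence t: "t > 0" using l by auto
      show "(v x has_real_derivative uN x t - sin t) (at t)"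
        unfolding v_def by (rule derivative_eq_intros uN_deriv[OF t] refl)+ simp
      show "((\<lambda>t. uN x t - sin t) has_real_derivative uNN x t - cos t) (at t)"
        by (rule derivative_eq_intros uNN_deriv[OF t] refl)+ simp
      show "(g has_real_derivative \<mu> * cos (\<mu> * (t - l))) (at t)"
        unfolding g_def by (auto intro!: derivative_eq_intros)
      show "((\<lambda>t. \<mu> * cos (\<mu> * (t - l))) has_real_derivative - (\<mu>\<^sup>2 * g t)) (at t)"
        unfolding g_def by (auto intro!: derivative_eq_intros simp: power2_eq_square)
    qed (use l in \<open>auto intro!: continuous_intros slice[OF v_cont] slice[OF uN_cont] slice[OF uNN_cont] g\<close>)
    also have "integral {l..r} (\<lambda>t. v x t * (- (\<mu>\<^sup>2 * g t))) = - \<mu>\<^sup>2 * integral {l..r} (\<lambda>t. v x t * g t)"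
      unfolding integral_mult_right[symmetric] by (intro integral_cong) (simp add: algebra_simps)
    finally show ?thesis
      using v_l[of x] unfolding moment_div_def moment_def g_def by (simp add: algebra_simps)
  qed
  obtain K where K: "\<And>x. \<bar>moment \<mu> l r x\<bar> \<le> K" using moment_bounded[of l r \<mu>] l by auto
  have "(moment \<mu> l r x + k) * (\<Sum>i\<in>UNIV. dV i x) = 0"
  proof (rule parabolic_liouville[where a = a and G = G and \<Lambda> = \<Lambda> and K = "K + \<bar>k\<bar>", OF dim a_sym a_psd a_bnd a_cont])
    show "continuous_on UNIV (\<lambda>x. moment \<mu> l r x + k)"
      unfolding moment_def using slice_moment_continuous[OF v_cont l(1) g] by (intro continuous_intros) (simp add: g_def)
    show "continuous_on UNIV (dV i)" for i
      unfolding dV_def by (intro continuous_intros da_cont a_cont G_cont H_cont)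
    show "((\<lambda>s. \<Sum>j\<in>UNIV. a i j (x + s *\<^sub>R axis i 1) * G j (x + s *\<^sub>R axis i 1)) has_real_derivative dV i x) (at 0)" for i x
    proof -
      have "((\<lambda>s. a i j (x + s *\<^sub>R axis i 1) * G j (x + s *\<^sub>R axis i 1)) has_real_derivative
          da i j x * G j x + a i j x * H i j x) (at 0)" for j
        using DERIV_mult[OF a_deriv[of i j x] G_deriv[of j x i]] by (simp add: add.commute mult.commute)
      thus ?thesis unfolding dV_def by (intro DERIV_sum)
    qed
    show "\<bar>moment \<mu> l r x + k\<bar> \<le> K + \<bar>k\<bar>" for x using K[of x] by linarith
    show "0 \<le> (moment \<mu> l r x + k) * (\<Sum>i\<in>UNIV. dV i x)" for x unfolding sum_dV by (rule sgn)
  qed (rule G_cont moment_deriv)+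
  thus ?thesis unfolding sum_dV .
qed

text \<open>On the upper face $1 - \cos t$ vanishes together with its derivative, so $v$ and $v_N$ agree with $u$
and $u_N$ there, and the sign of $u$ becomes the sign of \<open>moment_div\<close> because $\cos(r - l) = 1$.\<close>

lemma solution_on_next_period:
  fixes m :: nat
  defines "l \<equiv> 2 * pi * real m"
  assumes u_l: "\<And>x. u x l = 0"
    and t: "t \<in> {l..l + 2 * pi}"
  shows "u x t = 1 - cos t"
proof -
  define r where "r = l + 2 * pi"
  have l: "0 \<le> l" "l < r" by (simp_all add: l_def r_def)
  have r_eq: "r = 2 * pi * real (Suc m)" by (simp add: l_def r_def algebra_simps)
  have cos_lr: "cos l = 1" "cos r = 1" and sin_r: "sin r = 0"
    using cos_2npi[of m] cos_2npi[of "Suc m"] sin_2npi[of "Suc m"] unfolding r_eq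
    unfolding l_def by (simp_all only: mult_ac)
  have v_l: "v x l = 0" and v_r: "v x r = u x r" for x by (simp_all add: v_def u_l cos_lr)
  have rl: "r - l = 2 * pi" by (simp add: r_def)
  have u_r: "u x r = 0" for x
  proof -
    obtain K where K: "\<And>x. \<bar>moment 1 l r x\<bar> \<le> K" using moment_bounded[of l r 1] l by auto
    have pos: "moment 1 l r x + (K + 1) > 0" for x using K[of x] by linarith
    have div: "moment_div 1 l r x = u x r" for x by (simp add: moment_div_def v_r rl)
    have "(moment 1 l r x + (K + 1)) * moment_div 1 l r x = 0"
    proof (rule moment_liouville[OF l v_l])
      show "0 \<le> (moment 1 l r x + (K + 1)) * moment_div 1 l r x" for x
        unfolding div using pos[of x] u_nonneg[of r x] l by simp
    qed
    thus ?thesis using pos[of x] by (simp add: div)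
  qed
  \<comment> \<open>The face $t = r$ is interior to the half-space, and $u$ has its minimum $0$ there.\<close>
  have uN_r: "uN x r = 0" for x
  proof (rule DERIV_local_min)
    show "(u x has_real_derivative uN x r) (at r)" using l by (intro uN_deriv) auto
    show "0 < r" using l by simp
    show "\<forall>y. \<bar>r - y\<bar> < r \<longrightarrow> u x r \<le> u x y" using u_r u_nonneg by auto
  qed
  have moment_0: "moment \<mu> l r x = 0" if "\<mu> > 1" for \<mu> x
  proof -
    have \<mu>: "\<mu>\<^sup>2 - 1 > 0" using that by simp
    have div: "moment_div \<mu> l r x = (\<mu>\<^sup>2 - 1) * moment \<mu> l r x" for x
      by (simp add: moment_div_def v_r u_r uN_r sin_r)
    have "(moment \<mu> l r x + 0) * moment_div \<mu> l r x = 0"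
    proof (rule moment_liouville[OF l v_l])
      show "0 \<le> (moment \<mu> l r x + 0) * moment_div \<mu> l r x" for x
        unfolding div using \<mu> by (simp add: mult.left_commute[of _ "\<mu>\<^sup>2 - 1"])
    qed
    thus ?thesis using \<mu> by (simp add: div)
  qed
  have v_cont': "continuous_on {l..r} (v x)"
    using l by (intro continuous_on_compose_half_space[OF v_cont] continuous_intros) auto
  have "v x t = 0"
  proof (cases "t = l")
    case False
    show ?thesis
      by (rule sine_moments_zero_imp_zero[OF l(2) v_cont' moment_0[unfolded moment_def]])
         (use t False in \<open>auto simp: r_def\<close>)
  qed (simp add: v_l)
  thus ?thesis by (simp add: v_def)
qed

theorem solution_unique:
  assumes "t \<ge> 0"
  shows "u x t = 1 - cos t"
proof -
  have zero: "u x (2 * pi * real m) = 0" for m x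
  proof (induction m arbitrary: x)
    case (Suc m)
    have "u x (2 * pi * real (Suc m)) = 1 - cos (2 * pi * real (Suc m))"
      by (rule solution_on_next_period[of m], rule Suc.IH) (simp add: algebra_simps)
    also have "\<dots> = 0" using cos_2npi[of "Suc m"] by (simp only: mult_ac diff_self)
    finally show ?case .
  qed (simp add: u_zero)
  define m where "m = nat \<lfloor>t / (2 * pi)\<rfloor>"
  have "real m \<le> t / (2 * pi)" "t / (2 * pi) < real m + 1"
    unfolding m_def using assms by (auto simp: of_nat_nat)
  hence "2 * pi * real m \<le> t" "t < 2 * pi * real m + 2 * pi" by (simp_all add: field_simps)
  thus ?thesis by (intro solution_on_next_period[of m] zero) auto
qed

end

section \<open>The equation in coordinates\<close>

lemma partial_has_derivative:
  assumes "f differentiable_on S" "open S" "x \<in> S"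
  shows "((\<lambda>t. f (x + t *\<^sub>R b)) has_real_derivative partial b f x) (at 0)"
proof -
  have "f differentiable (at x)"
    using assms differentiable_on_eq_differentiable_at by blast
  then obtain f' where "(f has_derivative f') (at (x + 0 *\<^sub>R b))" by (auto simp: differentiable_def)
  moreover have "((\<lambda>t::real. x + t *\<^sub>R b) has_derivative (\<lambda>t. t *\<^sub>R b)) (at 0)"
    by (auto intro!: derivative_eq_intros)
  ultimately have D: "((\<lambda>t. f (x + t *\<^sub>R b)) has_derivative (\<lambda>t. f' (t *\<^sub>R b))) (at 0)"
    by (rule has_derivative_compose[rotated])
  hence "(\<lambda>t. f (x + t *\<^sub>R b)) differentiable (at 0)" by (auto simp: differentiable_def)
  thus ?thesis unfolding partial_def
    by (simp add: DERIV_deriv_iff_real_differentiable)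
qed

lemma closure_half_space: "closure (half_space :: ((real^'n) \<times> real) set) = UNIV \<times> {0..}"
  by (simp add: half_space_def closure_Times)

lemma open_half_space: "open (half_space :: ((real^'n) \<times> real) set)"
  by (simp add: half_space_def open_Times)

lemma zero_in_frontier_half_space: "(x, 0) \<in> frontier (half_space :: ((real^'n) \<times> real) set)"
  unfolding frontier_def closure_half_space interior_open[OF open_half_space] by (simp add: half_space_def)

lemma Basis_half_space:
  "(axis i 1, 0) \<in> (Basis :: ((real^'n) \<times> real) set)" "(0, 1) \<in> (Basis :: ((real^'n) \<times> real) set)"
  by (simp_all add: Basis_prod_def Basis_vec_def) auto

lemma grad_inner_Basis: "b \<in> Basis \<Longrightarrow> grad f x \<bullet> b = partial b f x"
  unfolding grad_def by (rule inner_sum_left_Basis)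

lemma sum_Basis_half_space:
  "(\<Sum>b\<in>Basis. F (b :: (real^'n) \<times> real)) = (\<Sum>i\<in>UNIV. F (axis i 1, 0)) + F (0, 1)"
proof -
  have B: "(Basis :: ((real^'n) \<times> real) set) = insert (0, 1) (range (\<lambda>i. (axis i 1, 0)))"
    by (auto simp: Basis_prod_def Basis_vec_def)
  have "(0, 1) \<notin> range (\<lambda>i::'n. (axis i (1::real), 0::real))" by auto
  moreover have "inj (\<lambda>i::'n. (axis i (1::real), 0::real))" by (auto simp: inj_on_def axis_eq_axis)
  ultimately show ?thesis unfolding B by (simp add: sum.reindex add.commute)
qed

lemma block_mult_grad_axis:
  "block_mult B (grad u y) \<bullet> (axis i 1, 0) = (\<Sum>j\<in>UNIV. B $ i $ j * partial (axis j 1, 0) u y)"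
proof -
  have "fst (grad u y) $ j = partial (axis j 1, 0) u y" for j
    using grad_inner_Basis[OF Basis_half_space(1)[of j], of u y]
    by (simp add: inner_prod_def inner_axis)
  thus ?thesis
    by (simp add: block_mult_def case_prod_unfold inner_prod_def inner_axis matrix_vector_mult_def)
qed

lemma block_mult_grad_normal: "block_mult B (grad u y) \<bullet> (0, 1) = partial (0, 1) u y"
  using grad_inner_Basis[OF Basis_half_space(2), of u y]
  by (simp add: block_mult_def case_prod_unfold inner_prod_def)

text \<open>The exceptional set is open and null, hence empty.\<close>

lemma continuous_L_infinity_bounded:
  assumes "continuous_on UNIV f" "L_infinity f"
  obtains C where "\<And>x. \<bar>f x\<bar> \<le> C"
proof -
  obtain C where C: "AE x in lebesgue. \<bar>f x\<bar> \<le> C" using assms(2) unfolding L_infinity_def by blast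
  have "open {x. C < \<bar>f x\<bar>}" by (intro open_Collect_less continuous_intros assms(1))
  moreover have "AE x in lebesgue. x \<notin> {x. C < \<bar>f x\<bar>}" using C by (rule AE_mp) (auto intro!: AE_I2)
  ultimately have "{x. C < \<bar>f x\<bar>} = {}" by (rule open_AE_notin_empty)
  thus ?thesis by (intro that[of C]) (auto simp: not_less)
qed

theorem theorem3p2:
  fixes Ahat :: "real^'n \<Rightarrow> real^'n^'n"
    and u :: "(real^'n) \<times> real \<Rightarrow> real"
  assumes dim: "DIM((real^'n) \<times> real) = 2 \<or> DIM((real^'n) \<times> real) = 3"
    and sym: "\<And>x'. transpose (Ahat x') = Ahat x'"
    and entries_C1: "\<And>i j. Ck_on 1 UNIV (\<lambda>x'. Ahat x' $ i $ j)"
    and entries_Linf: "\<And>i j. L_infinity (\<lambda>x'. Ahat x' $ i $ j)"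
    and pos: "\<And>x' \<xi>. \<xi> \<noteq> 0 \<Longrightarrow>
                (\<Sum>i\<in>UNIV. \<Sum>j\<in>UNIV. Ahat x' $ i $ j * \<xi> $ i * \<xi> $ j) > 0"
    and u_C2: "Ck_closure 2 half_space u"
    and eqn: "\<And>x. x \<in> half_space \<Longrightarrow>
                - divergence (\<lambda>y. block_mult (Ahat (fst y)) (grad u y)) x = u x - 1"
    and bdry: "\<And>x. x \<in> frontier half_space \<Longrightarrow> u x = 0"
    and strips: "\<And>M. M > 0 \<Longrightarrow> \<exists>C>0. \<forall>x \<in> UNIV \<times> {0..M}. 0 \<le> u x \<and> u x \<le> C"
  shows "\<forall>(x', xN) \<in> closure half_space. u (x', xN) = 1 - cos xN"
proof -
  let ?S = "half_space :: ((real^'n) \<times> real) set"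
  let ?e = "\<lambda>i::'n. (axis i 1, 0) :: (real^'n) \<times> real" and ?n = "(0, 1) :: (real^'n) \<times> real"
  have in_S: "(x, t) \<in> ?S \<longleftrightarrow> t > 0" for x t by (simp add: half_space_def)
  note basis = Basis_half_space[where 'n = 'n]
  have u_cont: "continuous_on (UNIV \<times> {0..}) u"
    and u_diff: "u differentiable_on ?S"
    and C1: "\<And>b. b \<in> Basis \<Longrightarrow> extends_cont ?S (partial b u)"
    and pu_diff: "\<And>b. b \<in> Basis \<Longrightarrow> partial b u differentiable_on ?S"
    and C2: "\<And>b b'. b \<in> Basis \<Longrightarrow> b' \<in> Basis \<Longrightarrow> extends_cont ?S (partial b' (partial b u))"
    using u_C2 unfolding Ck_closure_def closure_half_space by (simp_all add: numeral_2_eq_2)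
  \<comment> \<open>The continuous extensions of the first (\<open>g\<close>) and second (\<open>h\<close>) derivatives; they agree
    with \<open>partial\<close> in the open half-space only.\<close>
  have "\<forall>b\<in>Basis. \<exists>g. continuous_on (UNIV \<times> {0..}) g \<and> (\<forall>x\<in>?S. g x = partial b u x)"
    using C1 unfolding extends_cont_def closure_half_space by blast
  then obtain g where g: "\<And>b. b \<in> Basis \<Longrightarrow> continuous_on (UNIV \<times> {0..}) (g b)"
      "\<And>b x. b \<in> Basis \<Longrightarrow> x \<in> ?S \<Longrightarrow> g b x = partial b u x" by metis
  have "\<forall>b\<in>Basis. \<forall>b'\<in>Basis. \<exists>g. continuous_on (UNIV \<times> {0..}) g \<and> (\<forall>x\<in>?S. g x = partial b' (partial b u) x)"
    using C2 unfolding extends_cont_def closure_half_space by blast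
  then obtain h where h: "\<And>b b'. b \<in> Basis \<Longrightarrow> b' \<in> Basis \<Longrightarrow> continuous_on (UNIV \<times> {0..}) (h b b')"
      "\<And>b b' x. b \<in> Basis \<Longrightarrow> b' \<in> Basis \<Longrightarrow> x \<in> ?S \<Longrightarrow> h b b' x = partial b' (partial b u) x" by metis
  define a where "a i j x = Ahat x $ i $ j" for i j x
  define da where "da i j x = partial (axis i 1) (a i j) x" for i j x
  have a_diff: "a i j differentiable_on UNIV" and a_partial: "b \<in> Basis \<Longrightarrow> continuous_on UNIV (partial b (a i j))" for i j b
    using entries_C1[of i j] unfolding a_def[abs_def] by simp_all
  have a_cont: "continuous_on UNIV (a i j)" for i j
    by (rule differentiable_imp_continuous_on[OF a_diff])
  have a_deriv: "((\<lambda>s. a i j (x + s *\<^sub>R axis i 1)) has_real_derivative da i j x) (at 0)" for i j x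
    unfolding da_def by (rule partial_has_derivative[OF a_diff]) auto
  have "\<exists>C. \<forall>x. \<bar>a i j x\<bar> \<le> C" for i j
    using continuous_L_infinity_bounded[OF a_cont] entries_Linf[of i j] unfolding a_def[abs_def] by metis
  then obtain C where C: "\<And>i j x. \<bar>a i j x\<bar> \<le> C i j" by metis
  define \<Lambda> where "\<Lambda> = (\<Sum>i\<in>UNIV. \<Sum>j\<in>UNIV. C i j)"
  have C_nonneg: "0 \<le> C i j" for i j using C[of i j 0] by linarith
  have a_bnd: "\<bar>a i j x\<bar> \<le> \<Lambda>" for i j x
  proof -
    have "C i j \<le> (\<Sum>j\<in>UNIV. C i j)" by (rule member_le_sum) (simp_all add: C_nonneg)
    also have "\<dots> \<le> \<Lambda>" unfolding \<Lambda>_def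
      by (rule member_le_sum[where f = "\<lambda>i. \<Sum>j\<in>UNIV. C i j"]) (simp_all add: C_nonneg sum_nonneg)
    finally show ?thesis using C[of i j x] by linarith
  qed
  have u_line: "((\<lambda>s. u ((x, t) + s *\<^sub>R b)) has_real_derivative g b (x, t)) (at 0)"
    if "b \<in> Basis" "t > 0" for b x t
    using partial_has_derivative[OF u_diff open_half_space, of "(x, t)" b] that by (simp add: in_S g)
  have pu_line: "((\<lambda>s. partial b u ((x, t) + s *\<^sub>R b')) has_real_derivative h b b' (x, t)) (at 0)"
    if "b \<in> Basis" "b' \<in> Basis" "t > 0" for b b' x t
    using partial_has_derivative[OF pu_diff open_half_space, of b "(x, t)" b'] that by (simp add: in_S h)
  have vertical: "(f has_real_derivative D) (at t)" if "((\<lambda>s. f (t + s)) has_real_derivative D) (at 0)" for f D and t :: real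
    using that DERIV_at_within_shift[of f D t 0 UNIV] by simp
  interpret half_space_solution a da \<Lambda> "\<lambda>x t. u (x, t)" "\<lambda>x t. g ?n (x, t)" "\<lambda>x t. h ?n ?n (x, t)"
    "\<lambda>i x t. g (?e i) (x, t)" "\<lambda>i j x t. h (?e j) (?e i) (x, t)"
  proof
    show "CARD('n) \<le> 2" using dim by auto
    show "a i j x = a j i x" for i j x
      using arg_cong[OF sym[of x], of "\<lambda>A. A $ j $ i"] by (simp add: a_def transpose_def)
    show "0 \<le> (\<Sum>i\<in>UNIV. \<Sum>j\<in>UNIV. a i j x * \<xi> i * \<xi> j)" for x and \<xi> :: "'n \<Rightarrow> real"
    proof (cases "(\<chi> i. \<xi> i) = (0 :: real^'n)")
      case True
      hence "\<xi> i = 0" for i by (simp add: vec_eq_iff)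
      thus ?thesis by simp
    next
      case False
      from pos[OF this, of x] show ?thesis by (simp add: a_def)
    qed
    show "continuous_on UNIV (da i j)" for i j
      unfolding da_def by (rule a_partial) (auto simp: Basis_vec_def)
    show "((\<lambda>t. u (x, t)) has_real_derivative g ?n (x, t)) (at t)" if "t > 0" for x t
      by (rule vertical) (use u_line[OF basis(2) that, of x] in simp)
    show "((\<lambda>t. g ?n (x, t)) has_real_derivative h ?n ?n (x, t)) (at t)" if "t > 0" for x t
    proof (rule has_field_derivative_transform_within_open[where S = "{0<..}"])
      show "((\<lambda>t. partial ?n u (x, t)) has_real_derivative h ?n ?n (x, t)) (at t)"
        by (rule vertical) (use pu_line[OF basis(2) basis(2) that, of x] in simp)
    qed (use that in \<open>auto simp: g(2)[OF basis(2)] in_S\<close>)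
    show "((\<lambda>s. u (x + s *\<^sub>R axis i 1, t)) has_real_derivative g (?e i) (x, t)) (at 0)" if "t > 0" for i x t
      using u_line[OF basis(1) that] by simp
    show "((\<lambda>s. g (?e j) (x + s *\<^sub>R axis i 1, t)) has_real_derivative h (?e j) (?e i) (x, t)) (at 0)"
      if "t > 0" for i j x t
      using pu_line[OF basis(1) basis(1) that] that by (simp add: g(2)[OF basis(1)] in_S)
    show "(\<Sum>i\<in>UNIV. \<Sum>j\<in>UNIV. da i j x * g (?e j) (x, t) + a i j x * h (?e j) (?e i) (x, t)) + h ?n ?n (x, t)
        = 1 - u (x, t)" if t: "t > 0" for x t
    proof -
      let ?F = "\<lambda>y. block_mult (Ahat (fst y)) (grad u y)"
      have tangential: "partial (?e i) (\<lambda>y. ?F y \<bullet> ?e i) (x, t)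
          = (\<Sum>j\<in>UNIV. da i j x * g (?e j) (x, t) + a i j x * h (?e j) (?e i) (x, t))" for i
      proof -
        have "((\<lambda>s. a i j (x + s *\<^sub>R axis i 1) * partial (?e j) u ((x, t) + s *\<^sub>R ?e i)) has_real_derivative
            da i j x * g (?e j) (x, t) + a i j x * h (?e j) (?e i) (x, t)) (at 0)" for j
          using DERIV_mult[OF a_deriv[of i j x] pu_line[OF basis(1)[of j] basis(1)[of i] t, of x]] t
          by (simp add: g(2)[OF basis(1)] in_S add.commute mult.commute)
        hence "((\<lambda>s. \<Sum>j\<in>UNIV. a i j (x + s *\<^sub>R axis i 1) * partial (?e j) u ((x, t) + s *\<^sub>R ?e i)) has_real_derivative
            (\<Sum>j\<in>UNIV. da i j x * g (?e j) (x, t) + a i j x * h (?e j) (?e i) (x, t))) (at 0)"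
          by (intro DERIV_sum)
        from DERIV_imp_deriv[OF this] show ?thesis
          unfolding block_mult_grad_axis a_def by (subst partial_def) simp
      qed
      have normal: "partial ?n (\<lambda>y. ?F y \<bullet> ?n) (x, t) = h ?n ?n (x, t)"
        unfolding block_mult_grad_normal using h(2)[OF basis(2) basis(2), of "(x, t)"] t by (simp add: in_S)
      have "divergence ?F (x, t) = 1 - u (x, t)" using eqn[of "(x, t)"] t by (simp add: in_S)
      thus ?thesis unfolding divergence_def sum_Basis_half_space tangential normal .
    qed
    show "u (x, 0) = 0" for x by (rule bdry[OF zero_in_frontier_half_space])
    show "0 \<le> u (x, t)" if "t \<ge> 0" for x t
      using strips[of "t + 1"] that by fastforce
    show "\<exists>C. \<forall>x. \<forall>t\<in>{0..M}. u (x, t) \<le> C" for M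
      using strips[of "\<bar>M\<bar> + 1"] by (force intro: exI)
  qed (use u_cont g(1) h(1) basis a_cont a_bnd a_deriv in \<open>auto simp: case_prod_unfold\<close>)
  show ?thesis unfolding closure_half_space using solution_unique by auto
qed

end
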